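(* Consider the anisotropic TV regularized problem $$\min_{u\in X}\ D(u)+\alpha\|\nabla u\|_1,\qquad D(u)=\tfrac12\|Ku-z\|_2^2+\tfrac{\mu}{2}\|\nabla u\|_2^2,\tag{P}$$ and let $(u^k,p^k,\lambda^k)$ be the iteration sequence generated by the semismooth Newton based augmented Lagrangian method described in the context (with inner solver ALM-PDP, ALM-PDD or ALM-PT), with the stopping criterion (A). 1. The sequence $(u^k,p^k,\lambda^k)$ is bounded and converges to $(u^*,p^*,\lambda^* )$ globally. 2. If $T_d:=\partial d$ satisfies Assumption 1 (stated in the context) and is thus metrically subregular for the origin with modulus $\kappa_d$ through Assumption 1, then with the additional stopping criterion (B1) the sequence $\{\lambda^k\}$ converges to $\lambda^*\in\mathcal{X}^A$, and for all sufficiently large $k$ there is the local linear convergence $$\mathrm{dist}(\lambda^{k+1},\mathcal{X}^A)\le\theta_k\,\mathrm{dist}(\lambda^k,\mathcal{X}^A),$$ where $\theta_k=[\kappa_d(\kappa_d^2+\sigma_k^2)^{-1/2}+\delta_k](1-\delta_k)^{-1}$ and, as $k\to\infty$, $\theta_k\to\theta_\infty=\kappa_d(\kappa_d^2+\sigma_\infty^2)^{-1/2}<1$. 3. If in addition $T_l$ is metrically subregular at $(u^*,p^*,\lambda^* )$ for the origin with modulus $\kappa_l$ and the stopping criterion (B2) is employed, then for all sufficiently large $k$ $$\|(u^{k+1},p^{k+1})-(u^*,p^* )\|\le\theta_k'\,\|\lambda^{k+1}-\lambda^k\|,$$ where $\theta_k'=\kappa_l(1+\delta_k')/\sigma_k$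 with $\lim_{k\to\infty}\theta_k'=\kappa_l/\sigma_\infty$.
   Context: Setting. $\Omega=\{1,\dots,M\}\times\{1,\dots,N\}$, $X=\mathbb{R}^\Omega$ and $Y=X^2$ with their standard Euclidean inner products. $\nabla u=(\nabla_1u,\nabla_2u)\in Y$, with $(\nabla_1u)_{i,j}=u_{i+1,j}-u_{i,j}$ for $i<M$ and $0$ for $i=M$; $(\nabla_2u)_{i,j}=u_{i,j+1}-u_{i,j}$ for $j<N$ and $0$ for $j=N$; $\mathrm{div}=-\nabla^*$. $K$ is a linear operator on $X$, $z\in X$ the data, $\mu\ge0$, $\alpha>0$, $f=K^*z$, and $H=\mu\nabla^*\nabla+K^*K$ is positive definite; $\|v\|_{H^{-1}}^2=\langle H^{-1}v,v\rangle$. Anisotropic norm: $\|p\|_1=\sum_{(i,j)\in\Omega}(|(p_1)_{i,j}|+|(p_2)_{i,j}|)$. Dual problem: minimize $d(\lambda)=\frac12\|\mathrm{div}\,\lambda+f\|_{H^{-1}}^2-\frac12\|z\|_2^2+\mathcal{I}_{\{\|\lambda\|_\infty\le\alpha\}}(\lambda)$ over $\lambda\in Y$, where $\mathcal I$ is the indicator function and, in the anisotropic case, the constraint means $|(\lambda_k)_{i,j}|\le\alpha$ for $k=1,2$ and all $(i,j)\in\Omega$. $\mathcal{X}^A$ is its solution set. $(u^*,p^* )$ is the primal solution, with $p^*=\nabla u^*$, and $\lambda^*$ is a dual solution. KKT operator: $T_l(u,p,\lambda)=\{Hu-f+\nabla^*\lambda\}\times(-\lambda+\alpha\,\partial\|\cdot\|_1(p))\times\{p-\nabla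 u\}$. Assumption 1 (on a dual solution). Vectorize $\lambda\in Y$ as $\lambda=(\lambda_1,\dots,\lambda_m)^T$, $\lambda_i\in\mathbb{R}^2$, $m=MN$ (one block per pixel). Let $\mathbb{B}_\alpha^i(0)=\{\lambda_i\in\mathbb{R}^2:|\lambda_i|\le\alpha\}$ be the closed Euclidean disc and $\mathcal{N}_{\mathbb{B}_\alpha^i(0)}=\partial\mathcal{I}_{\mathbb{B}_\alpha^i(0)}$ its normal cone. Assumption 1 is formulated for the model of minimizing $\frac12\|A\lambda-b\|^2+\langle q,\lambda\rangle+a_0$ ($A\in\mathbb{R}^{m\times 2m}$, $b\in\mathbb{R}^m$, $q\in\mathbb{R}^{2m}$, $a_0$ a constant) subject to $\lambda_i\in\mathbb{B}_\alpha^i(0)$ for all $i$; the quadratic term of $d$ corresponds to $A=H^{-1/2}\mathrm{div}$, $b=-H^{-1/2}f$, $q=0$. Let $\mathcal{X}$ be the solution set, $\bar y$ the common value of $A\lambda$ on $\mathcal{X}$, and $\bar g=A^T(\bar y-b)+q=(\bar g_1,\dots,\bar g_m)^T$, $\bar g_i\in\mathbb{R}^2$. Assumption 1: $\bar\lambda\in\mathcal{X}$ and, for each $i$, either (i) $\bar\lambda_i\in\mathrm{bd}\,\mathbb{B}_\alpha^i(0)$ and there exists $\bar g_i\ne0$ such that $-\bar g_i\in\mathcal{N}_{\mathbb{B}_\alpha^i(0)}(\bar\lambda_i)$, or (ii) $\bar\lambda_i\in\mathrm{int}\,\mathbb{B}_\alpha^i(0)$. Augmented Lagrangian: $\Phi_k(u,p)=L(u,p;\lambda^k)=D(u)+\alpha\|p\|_1+\langle\lambda^k,\nabla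 u-p\rangle+\frac{\sigma_k}{2}\|\nabla u-p\|_2^2$. Algorithm. Given $\lambda^0\in Y$ and positive nondecreasing step sizes $\sigma_k\to\sigma_\infty<+\infty$, for $k=0,1,\dots$: compute $u^{k+1}$ as an approximate minimizer in $u$ of $\min_p\Phi_k(u,p)$, by applying an inner semismooth Newton method to its optimality condition $Hu-f+\nabla^*\mathcal{P}_\alpha(\lambda^k+\sigma_k\nabla u)=0$ until the stopping criteria below hold; then set $p^{k+1}=S_{\alpha/\sigma_k}(\lambda^k/\sigma_k+\nabla u^{k+1})$ and $\lambda^{k+1}=\lambda^k+\sigma_k(\nabla u^{k+1}-p^{k+1})=\mathcal{P}_\alpha(\lambda^k+\sigma_k\nabla u^{k+1})$. Here $\mathcal{P}_\alpha$ is the orthogonal projection onto $\{\|\lambda\|_\infty\le\alpha\}$ and $S_a=(I+a\,\partial\|\cdot\|_1)^{-1}$ is (componentwise) soft thresholding. Inner solvers: ALM-PDP and ALM-PDD apply a primal-dual semismooth Newton method to the equivalent system in $(u,h)$ with auxiliary variable $h=\mathcal{P}_\alpha(\lambda^k+\sigma_k\nabla u)$, eliminating $h$ (PDP) or $u$ (PDD) from each Newton system and projecting $h$ onto $\{\|h\|_\infty\le\alpha\}$ after each step; ALM-PT applies semismooth Newton with Armijo line search directly to the equation in $u$ written with the soft thresholding operator. Stopping criteria: (A) $\Phi_k(u^{k+1},p^{k+1})-\inf\Phi_k\le\epsilon_k^2/(2\sigma_k)$, $\sum_{k=0}^\infty\epsilon_k<\infty$; (B1) $\Phi_k(u^{k+1},p^{k+1})-\inf\Phi_k\le\frac{\delta_k^2}{2\sigma_k}\|\lambda^{k+1}-\lambda^k\|^2$,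 $\sum_{k=0}^\infty\delta_k<\infty$; (B2) $\mathrm{dist}(0,\partial\Phi_k(u^{k+1},p^{k+1}))\le\frac{\delta_k'}{\sigma_k}\|\lambda^{k+1}-\lambda^k\|$, $0\le\delta_k'\to0$ (with $\epsilon_k,\delta_k\ge0$). Metric subregularity: a set-valued map $F$ is metrically subregular at $\bar x$ for $\bar y$ with modulus $\kappa\ge0$ if $\bar y\in F(\bar x)$ and there are neighborhoods $U$ of $\bar x$, $V$ of $\bar y$ with $\mathrm{dist}(x,F^{-1}(\bar y))\le\kappa\,\mathrm{dist}(\bar y,F(x)\cap V)$ for all $x\in U$ (with $\mathrm{dist}(\cdot,\emptyset)=+\infty$). "For the origin" means $\bar y=0$. *)

theory Defs
  imports "HOL-Analysis.Analysis"
begin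

subsection \<open>Convex analysis\<close>

definition subdiff :: "('a::real_inner \<Rightarrow> ereal) \<Rightarrow> 'a \<Rightarrow> 'a set" where
  "subdiff f x = {g. \<bar>f x\<bar> \<noteq> \<infinity> \<and> (\<forall>y. f x + ereal (g \<bullet> (y - x)) \<le> f y)}"

definition cvx_ind :: "'a set \<Rightarrow> 'a \<Rightarrow> ereal" where
  "cvx_ind C x = (if x \<in> C then 0 else \<infinity>)"

definition normal_cone :: "'a::real_inner set \<Rightarrow> 'a \<Rightarrow> 'a set" where
  "normal_cone C = subdiff (cvx_ind C)"

text \<open>
  The premise \<open>F x \<inter> V \<noteq> {}\<close> implements the convention that the distance to the empty set is
  infinite (also for \<open>\<kappa> = 0\<close>), since \<^const>\<open>infdist\<close> to the empty set is \<open>0\<close>.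
\<close>

definition metric_subreg ::
  "('a::metric_space \<Rightarrow> 'b::metric_space set) \<Rightarrow> 'a \<Rightarrow> 'b \<Rightarrow> real \<Rightarrow> bool" where
  "metric_subreg F x0 y0 \<kappa> \<longleftrightarrow> 0 \<le> \<kappa> \<and> y0 \<in> F x0 \<and>
     (\<exists>U V. open U \<and> x0 \<in> U \<and> open V \<and> y0 \<in> V \<and>
        (\<forall>x\<in>U. F x \<inter> V \<noteq> {} \<longrightarrow>
           infdist x {x'. y0 \<in> F x'} \<le> \<kappa> * infdist y0 (F x \<inter> V)))"


subsection \<open>Images, discrete gradient and divergence\<close>

text \<open>
  The pixel grid \<open>{1..M} \<times> {1..N}\<close> is \<open>'m \<times> 'n\<close> for finite linear orders \<open>'m\<close>, \<open>'n\<close> with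
  \<open>M = CARD('m)\<close> and \<open>N = CARD('n)\<close>; the row (column) number of \<open>i\<close> is \<open>card {..i}\<close>.
\<close>

type_synonym ('m, 'n) img = "real ^ ('m \<times> 'n)"
type_synonym ('m, 'n) fld = "(real ^ ('m \<times> 'n)) \<times> (real ^ ('m \<times> 'n))"

definition is_last :: "'a::{finite,linorder} \<Rightarrow> bool" where
  "is_last i \<longleftrightarrow> (\<forall>j. j \<le> i)"

definition nxt :: "'a::{finite,linorder} \<Rightarrow> 'a" where
  "nxt i = Min {j. i < j}"

lemma bij_betw_coordinate:
  "bij_betw (\<lambda>i::'a::{finite,linorder}. card {..i}) UNIV {1..CARD('a)}"
proof -
  have less: "card {..i} < card {..j}" if "i < j" for i j :: 'a
    by (rule psubset_card_mono) (use that in auto)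
  then have inj: "inj (\<lambda>i::'a. card {..i})"
    by (metis (mono_tags, lifting) injI less_irrefl linorder_neqE)
  have "card {..i} \<in> {1..CARD('a)}" for i :: 'a
  proof -
    have "card {..i} \<noteq> 0" by (auto simp: card_eq_0_iff)
    moreover have "card {..i} \<le> CARD('a)" by (rule card_mono) auto
    ultimately show ?thesis by (metis atLeastAtMost_iff less_one not_less)
  qed
  then have "(\<lambda>i::'a. card {..i}) ` UNIV \<subseteq> {1..CARD('a)}" by blast
  moreover have "card ((\<lambda>i::'a. card {..i}) ` UNIV) = card {1..CARD('a)}"
    using card_image[OF inj] by simp
  ultimately have "(\<lambda>i::'a. card {..i}) ` UNIV = {1..CARD('a)}"
    by (intro card_subset_eq) auto
  with inj show ?thesis by (simp add: bij_betw_def)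
qed

lemma coordinate_nxt:
  fixes i :: "'a::{finite,linorder}"
  assumes "\<not> is_last i"
  shows "card {..nxt i} = card {..i} + 1"
proof -
  have ne: "{j. i < j} \<noteq> {}" using assms by (auto simp: is_last_def not_le)
  have "nxt i \<in> {j. i < j}" unfolding nxt_def using ne by (intro Min_in) auto
  moreover have "nxt i \<le> j" if "\<not> j \<le> i" for j using that unfolding nxt_def by (intro Min_le) auto
  ultimately have nx: "i < nxt i" "\<And>j. \<not> j \<le> i \<Longrightarrow> nxt i \<le> j" by auto
  have "{..nxt i} = insert (nxt i) {..i}"
  proof (intro equalityI subsetI)
    fix j assume "j \<in> {..nxt i}"
    then show "j \<in> insert (nxt i) {..i}" using nx(2)[of j] by auto
  next
    fix j assume "j \<in> insert (nxt i) {..i}"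
    then show "j \<in> {..nxt i}" using nx(1) by auto
  qed
  moreover have "nxt i \<notin> {..i}" using nx(1) by auto
  ultimately show ?thesis by simp
qed

definition grad1 :: "('m::{finite,linorder}, 'n::{finite,linorder}) img \<Rightarrow> ('m, 'n) img" where
  "grad1 u = (\<chi> x. case x of (i, j) \<Rightarrow> if is_last i then 0 else u $ (nxt i, j) - u $ (i, j))"

definition grad2 :: "('m::{finite,linorder}, 'n::{finite,linorder}) img \<Rightarrow> ('m, 'n) img" where
  "grad2 u = (\<chi> x. case x of (i, j) \<Rightarrow> if is_last j then 0 else u $ (i, nxt j) - u $ (i, j))"

definition grad :: "('m::{finite,linorder}, 'n::{finite,linorder}) img \<Rightarrow> ('m, 'n) fld" where
  "grad u = (grad1 u, grad2 u)"

definition div_op :: "('m::{finite,linorder}, 'n::{finite,linorder}) fld \<Rightarrow> ('m, 'n) img" where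
  "div_op q = - adjoint grad q"

definition norm1 :: "('m::{finite,linorder}, 'n::{finite,linorder}) fld \<Rightarrow> real" where
  "norm1 p = (\<Sum>x\<in>UNIV. \<bar>fst p $ x\<bar> + \<bar>snd p $ x\<bar>)"

definition sub_norm1 :: "('m::{finite,linorder}, 'n::{finite,linorder}) fld \<Rightarrow> ('m, 'n) fld set" where
  "sub_norm1 = subdiff (\<lambda>p. ereal (norm1 p))"

definition box_inf :: "real \<Rightarrow> ('m::{finite,linorder}, 'n::{finite,linorder}) fld set" where
  "box_inf \<alpha> = {q. \<forall>x. \<bar>fst q $ x\<bar> \<le> \<alpha> \<and> \<bar>snd q $ x\<bar> \<le> \<alpha>}"


subsection \<open>Primal and dual problem, KKT operator\<close>

definition H_op ::
  "(('m::{finite,linorder}, 'n::{finite,linorder}) img \<Rightarrow> ('m, 'n) img) \<Rightarrow> real \<Rightarrow>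
   ('m, 'n) img \<Rightarrow> ('m, 'n) img" where
  "H_op K \<mu> u = \<mu> *\<^sub>R adjoint grad (grad u) + adjoint K (K u)"

definition pos_def :: "('a::real_inner \<Rightarrow> 'a) \<Rightarrow> bool" where
  "pos_def T \<longleftrightarrow> (\<forall>v. v \<noteq> 0 \<longrightarrow> 0 < T v \<bullet> v)"

definition D_fun where
  "D_fun K z \<mu> u = (norm (K u - z))\<^sup>2 / 2 + \<mu> / 2 * (norm (grad u))\<^sup>2"

definition primal_obj where
  "primal_obj K z \<mu> \<alpha> u = D_fun K z \<mu> u + \<alpha> * norm1 (grad u)"

definition primal_solution where
  "primal_solution K z \<mu> \<alpha> u p \<longleftrightarrow>
     (\<forall>v. primal_obj K z \<mu> \<alpha> u \<le> primal_obj K z \<mu> \<alpha> v) \<and> p = grad u"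

definition dual_obj ::
  "(('m::{finite,linorder}, 'n::{finite,linorder}) img \<Rightarrow> ('m, 'n) img) \<Rightarrow> ('m, 'n) img \<Rightarrow>
   real \<Rightarrow> real \<Rightarrow> ('m, 'n) fld \<Rightarrow> ereal" where
  "dual_obj K z \<mu> \<alpha> q =
     (let r = div_op q + adjoint K z
      in ereal (inv (H_op K \<mu>) r \<bullet> r / 2 - (norm z)\<^sup>2 / 2)) + cvx_ind (box_inf \<alpha>) q"

definition dual_solutions where
  "dual_solutions K z \<mu> \<alpha> = {q. \<forall>q'. dual_obj K z \<mu> \<alpha> q \<le> dual_obj K z \<mu> \<alpha> q'}"

definition T_d where
  "T_d K z \<mu> \<alpha> = subdiff (dual_obj K z \<mu> \<alpha>)"

definition T_l where
  "T_l K z \<mu> \<alpha> = (\<lambda>(u, p, q).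
     {H_op K \<mu> u - adjoint K z + adjoint grad q} \<times>
     ((\<lambda>g. - q + \<alpha> *\<^sub>R g) ` sub_norm1 p) \<times>
     {p - grad u})"


subsection \<open>Assumption on a dual solution\<close>

definition block :: "('m::{finite,linorder}, 'n::{finite,linorder}) fld \<Rightarrow> 'm \<times> 'n \<Rightarrow> real \<times> real" where
  "block q i = (fst q $ i, snd q $ i)"

definition model_solutions ::
  "(('m::{finite,linorder}, 'n::{finite,linorder}) fld \<Rightarrow> ('m, 'n) img) \<Rightarrow> ('m, 'n) img \<Rightarrow>
   ('m, 'n) fld \<Rightarrow> real \<Rightarrow> real \<Rightarrow> ('m, 'n) fld set" where
  "model_solutions A b c a0 \<alpha> =
     (let obj = (\<lambda>q. (norm (A q - b))\<^sup>2 / 2 + c \<bullet> q + a0);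
          feas = {q. \<forall>i. block q i \<in> cball 0 \<alpha>}
      in {q \<in> feas. \<forall>q'\<in>feas. obj q \<le> obj q'})"

definition assumption1 ::
  "(('m::{finite,linorder}, 'n::{finite,linorder}) fld \<Rightarrow> ('m, 'n) img) \<Rightarrow> ('m, 'n) img \<Rightarrow>
   ('m, 'n) fld \<Rightarrow> real \<Rightarrow> real \<Rightarrow> ('m, 'n) fld \<Rightarrow> bool" where
  "assumption1 A b c a0 \<alpha> q \<longleftrightarrow>
     (let y = (THE y. A ` model_solutions A b c a0 \<alpha> = {y});
          g = adjoint A (y - b) + c
      in q \<in> model_solutions A b c a0 \<alpha> \<and>
         (\<forall>i. (block q i \<in> frontier (cball 0 \<alpha>) \<and> block g i \<noteq> 0 \<and>
                 - block g i \<in> normal_cone (cball 0 \<alpha>) (block q i)) \<or>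
              block q i \<in> interior (cball 0 \<alpha>)))"

text \<open>The unique positive semidefinite square root of a self-adjoint positive semidefinite map.\<close>

definition psd_sqrt :: "('a::euclidean_space \<Rightarrow> 'a) \<Rightarrow> 'a \<Rightarrow> 'a" where
  "psd_sqrt T = (THE S. linear S \<and> adjoint S = S \<and> (\<forall>v. 0 \<le> S v \<bullet> v) \<and> S \<circ> S = T)"

text \<open>\<open>A = H\<^sup>-\<^sup>1\<^sup>/\<^sup>2 div\<close>, \<open>b = - H\<^sup>-\<^sup>1\<^sup>/\<^sup>2 f\<close>, zero linear term.\<close>

definition dual_assumption1 where
  "dual_assumption1 K z \<mu> \<alpha> q \<longleftrightarrow>
     (let R = psd_sqrt (inv (H_op K \<mu>))
      in assumption1 (R \<circ> div_op) (- R (adjoint K z)) 0 (- (norm z)\<^sup>2 / 2) \<alpha> q)"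


subsection \<open>Augmented Lagrangian method\<close>

definition aug_lag ::
  "(('m::{finite,linorder}, 'n::{finite,linorder}) img \<Rightarrow> ('m, 'n) img) \<Rightarrow> ('m, 'n) img \<Rightarrow>
   real \<Rightarrow> real \<Rightarrow> real \<Rightarrow> ('m, 'n) fld \<Rightarrow> ('m, 'n) img \<times> ('m, 'n) fld \<Rightarrow> real" where
  "aug_lag K z \<mu> \<alpha> s q = (\<lambda>(u, p).
     D_fun K z \<mu> u + \<alpha> * norm1 p + q \<bullet> (grad u - p) + s / 2 * (norm (grad u - p))\<^sup>2)"

text \<open>So the real-valued infimum in the stopping criteria below is the intended one.\<close>

lemma bdd_below_aug_lag:
  assumes "0 \<le> \<mu>" "0 \<le> \<alpha>" "0 < s"
  shows "bdd_below (range (aug_lag K z \<mu> \<alpha> s q))"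
proof -
  have "- (norm q)\<^sup>2 / (2 * s) \<le> aug_lag K z \<mu> \<alpha> s q (u, p)" for u p
  proof -
    define w where "w = grad u - p"
    have "0 \<le> (norm (q + s *\<^sub>R w))\<^sup>2 / (2 * s)" using assms by simp
    also have "\<dots> = (norm q)\<^sup>2 / (2 * s) + q \<bullet> w + s / 2 * (norm w)\<^sup>2"
      using assms unfolding power2_norm_eq_inner
      by (simp add: inner_simps inner_commute field_simps power2_eq_square)
    finally have "- (norm q)\<^sup>2 / (2 * s) \<le> q \<bullet> w + s / 2 * (norm w)\<^sup>2" by simp
    moreover have "0 \<le> D_fun K z \<mu> u" using assms by (simp add: D_fun_def)
    moreover have "0 \<le> \<alpha> * norm1 p" using assms by (simp add: norm1_def sum_nonneg)
    ultimately show ?thesis by (simp add: aug_lag_def w_def)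
  qed
  then show ?thesis by (auto intro!: bdd_belowI)
qed

text \<open>The resolvent \<open>(I + a \<partial>\<parallel>\<cdot>\<parallel>\<^sub>1)\<^sup>-\<^sup>1\<close>.\<close>

definition soft :: "real \<Rightarrow> ('m::{finite,linorder}, 'n::{finite,linorder}) fld \<Rightarrow> ('m, 'n) fld" where
  "soft a w = (THE p. \<exists>g\<in>sub_norm1 p. w = p + a *\<^sub>R g)"

text \<open>
  \<open>u (Suc k)\<close> is restricted only by the stopping criteria, so every inner solver is covered;
  \<open>u 0\<close> and \<open>p 0\<close> are not used by the method.
\<close>

definition alm_sequence ::
  "real \<Rightarrow> (nat \<Rightarrow> real) \<Rightarrow> (nat \<Rightarrow> ('m::{finite,linorder}, 'n::{finite,linorder}) img) \<Rightarrow>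
   (nat \<Rightarrow> ('m, 'n) fld) \<Rightarrow> (nat \<Rightarrow> ('m, 'n) fld) \<Rightarrow> bool" where
  "alm_sequence \<alpha> \<sigma> u p l \<longleftrightarrow> (\<forall>k.
     p (Suc k) = soft (\<alpha> / \<sigma> k) ((1 / \<sigma> k) *\<^sub>R l k + grad (u (Suc k))) \<and>
     l (Suc k) = l k + \<sigma> k *\<^sub>R (grad (u (Suc k)) - p (Suc k)))"

definition crit_A where
  "crit_A K z \<mu> \<alpha> \<sigma> u p l \<epsilon> \<longleftrightarrow>
     (\<forall>k. 0 \<le> \<epsilon> k) \<and> summable \<epsilon> \<and>
     (\<forall>k::nat. aug_lag K z \<mu> \<alpha> (\<sigma> k) (l k) (u (Suc k), p (Suc k)) -
           (INF w. aug_lag K z \<mu> \<alpha> (\<sigma> k) (l k) w) \<le> (\<epsilon> k)\<^sup>2 / (2 * \<sigma> k))"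

definition crit_B1 where
  "crit_B1 K z \<mu> \<alpha> \<sigma> u p l \<delta> \<longleftrightarrow>
     (\<forall>k. 0 \<le> \<delta> k) \<and> summable \<delta> \<and>
     (\<forall>k::nat. aug_lag K z \<mu> \<alpha> (\<sigma> k) (l k) (u (Suc k), p (Suc k)) -
           (INF w. aug_lag K z \<mu> \<alpha> (\<sigma> k) (l k) w)
         \<le> (\<delta> k)\<^sup>2 / (2 * \<sigma> k) * (norm (l (Suc k) - l k))\<^sup>2)"

text \<open>
  The subdifferential below is that of a finite convex function, hence nonempty, so
  \<^const>\<open>infdist\<close> is the distance.
\<close>

definition crit_B2 where
  "crit_B2 K z \<mu> \<alpha> \<sigma> u p l \<delta>' \<longleftrightarrow>
     (\<forall>k. 0 \<le> \<delta>' k) \<and> \<delta>' \<longlonglongrightarrow> 0 \<and>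
     (\<forall>k::nat. infdist 0 (subdiff (\<lambda>w. ereal (aug_lag K z \<mu> \<alpha> (\<sigma> k) (l k) w)) (u (Suc k), p (Suc k)))
         \<le> \<delta>' k / \<sigma> k * norm (l (Suc k) - l k))"

definition rate_d :: "real \<Rightarrow> real \<Rightarrow> real" where
  "rate_d \<kappa> s = \<kappa> / sqrt (\<kappa>\<^sup>2 + s\<^sup>2)"

end

theory Submission
  imports Defs
begin

text \<open>
  The method is an inexact proximal point iteration for the dual problem. If \<open>\<lambda>\<close> is the exact
  proximal point of the current multiplier and \<open>(\<upsilon>, \<pi>)\<close> the primal point belonging to it, then the
  gap of the augmented Lagrangian is at least
  \<open>\<parallel>u - \<upsilon>\<parallel>\<^sub>H\<^sup>2 / 2 + \<parallel>l' - \<lambda>\<parallel>\<^sup>2 / (2 \<sigma>)\<close> for every \<open>(u, p)\<close> with updated multiplier \<open>l'\<close>.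
  Hence (A) bounds the error of both the multiplier and \<open>u\<close>; the multipliers are quasi-Fejer
  monotone with respect to the dual solutions and therefore converge.

  The dual rate combines firm nonexpansiveness of the proximal map with metric subregularity.
  Assumption 1 forces strict complementarity in every single coordinate of the box, so that near
  the solution the inclusion \<open>v \<in> T\<^sub>d q\<close> is a linear system and the subregularity modulus comes from a
  linear right inverse. The primal rate holds because the KKT operator at the new iterate consists
  of the subdifferential of the augmented Lagrangian and the multiplier step divided by \<open>-\<sigma>\<close>.
\<close>

subsection \<open>Square roots of positive semidefinite maps\<close>

text \<open>A parabola through the origin that stays nonnegative has slope zero there. This replaces
  differentiation along a line in first-order conditions.\<close>

lemma quadratic_nonneg_linear_zero:
  fixes a b :: real
  assumes "\<And>t. 0 \<le> 2 * t * a + t\<^sup>2 * b"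
  shows "a = 0"
proof (rule ccontr)
  assume "a \<noteq> 0"
  define c where "c = \<bar>b\<bar> + 1"
  have c: "c > 0" "b \<le> c" by (auto simp: c_def)
  have "0 \<le> 2 * (- a / c) * a + (- a / c)\<^sup>2 * b" by (rule assms)
  also have "\<dots> \<le> 2 * (- a / c) * a + (- a / c)\<^sup>2 * c"
    using c by (intro add_left_mono mult_left_mono) auto
  also have "\<dots> = - (a\<^sup>2 / c)"
    using c by (simp add: power2_eq_square field_simps)
  also have "\<dots> < 0" using \<open>a \<noteq> 0\<close> c by simp
  finally show False by simp
qed

text \<open>Rayleigh quotient: a maximizer of \<open>T v \<bullet> v\<close> on the unit sphere of
  \<open>U\<close> is an eigenvector, and the maximum is its eigenvalue.\<close>

lemma selfadjoint_eigenvector: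
  fixes T :: "'a::euclidean_space \<Rightarrow> 'a"
  assumes T: "linear T" and sa: "\<And>v w. T v \<bullet> w = v \<bullet> T w"
    and U: "subspace U" "T ` U \<subseteq> U" "U \<noteq> {0}"
  obtains v c where "v \<in> U" "norm v = 1" "T v = c *\<^sub>R v"
proof -
  let ?S = "sphere 0 1 \<inter> U"
  obtain w where w: "w \<in> U" "w \<noteq> 0" using U subspace_0 by blast
  then have "w /\<^sub>R norm w \<in> ?S" using U(1) by (simp add: subspace_scale)
  then have "?S \<noteq> {}" by blast
  moreover have "compact ?S" by (intro compact_Int_closed closed_subspace U) auto
  moreover have "continuous_on ?S (\<lambda>v. T v \<bullet> v)"
    using T by (intro continuous_intros linear_continuous_on) (simp add: linear_conv_bounded_linear)
  ultimately obtain v where v: "v \<in> ?S" and max: "\<And>w. w \<in> ?S \<Longrightarrow> T w \<bullet> w \<le> T v \<bullet> v"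
    using continuous_attains_sup[of ?S "\<lambda>v. T v \<bullet> v"] by blast
  define c where "c = T v \<bullet> v"
  have vv: "v \<bullet> v = 1" using v by (simp add: norm_eq_1)
  have le: "T w \<bullet> w \<le> c * (w \<bullet> w)" if "w \<in> U" for w
  proof (cases "w = 0")
    case False
    then have "w /\<^sub>R norm w \<in> ?S" using that U(1) by (simp add: subspace_scale)
    then have "T (w /\<^sub>R norm w) \<bullet> (w /\<^sub>R norm w) \<le> c" using max c_def by blast
    then have "T w \<bullet> w / (norm w)\<^sup>2 \<le> c"
      by (simp add: linear_cmul[OF T] divide_inverse power2_eq_square ac_simps)
    then show ?thesis using False by (simp add: pos_divide_le_eq power2_norm_eq_inner)
  qed (simp add: linear_0[OF T])
  \<comment> \<open>The residual of the eigenvalue equation lies in \<open>U\<close> and serves as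
    the perturbation direction; the linear coefficient of the resulting parabola is twice
    \<open>d \<bullet> d\<close>.\<close>
  define d where "d = c *\<^sub>R v - T v"
  have dU: "d \<in> U" unfolding d_def using v U by (intro subspace_diff subspace_scale) auto
  have "0 \<le> 2 * t * (d \<bullet> d) + t\<^sup>2 * (c * (d \<bullet> d) - T d \<bullet> d)" for t
  proof -
    have "v + t *\<^sub>R d \<in> U" using v dU U(1) by (simp add: subspace_add subspace_scale)
    from le[OF this] have "0 \<le> c * ((v + t *\<^sub>R d) \<bullet> (v + t *\<^sub>R d)) - T (v + t *\<^sub>R d) \<bullet> (v + t *\<^sub>R d)"
      by simp
    also have "\<dots> = (c * (v \<bullet> v) - T v \<bullet> v) + 2 * t * (c * (v \<bullet> d) - T v \<bullet> d)
        + t\<^sup>2 * (c * (d \<bullet> d) - T d \<bullet> d)"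
      using sa[of d v]
      by (simp add: linear_add[OF T] linear_cmul[OF T] inner_simps inner_commute power2_eq_square algebra_simps)
    also have "c * (v \<bullet> d) - T v \<bullet> d = d \<bullet> d"
      by (simp add: d_def inner_diff_left)
    finally show ?thesis using vv by (simp add: c_def)
  qed
  then have "d \<bullet> d = 0" by (rule quadratic_nonneg_linear_zero)
  then have "T v = c *\<^sub>R v" by (simp add: d_def)
  with v show ?thesis by (intro that) auto
qed

text \<open>Split off one eigenvector and recurse on its orthogonal complement in \<open>U\<close>,
  which \<open>T\<close> leaves invariant because it is self-adjoint.\<close>

lemma selfadjoint_eigenbasis:
  fixes T :: "'a::euclidean_space \<Rightarrow> 'a"
  assumes T: "linear T" and sa: "\<And>v w. T v \<bullet> w = v \<bullet> T w"
    and "subspace U" "T ` U \<subseteq> U"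
  shows "\<exists>B c. finite B \<and> pairwise orthogonal B \<and> (\<forall>b\<in>B. norm b = 1 \<and> T b = c b *\<^sub>R b) \<and> span B = U"
  using assms(3,4)
proof (induction "dim U" arbitrary: U rule: less_induct)
  case less
  show ?case
  proof (cases "U = {0}")
    case True
    then show ?thesis by (intro exI[of _ "{}"]) auto
  next
    case False
    obtain v a where v: "v \<in> U" "norm v = 1" "T v = a *\<^sub>R v"
      using selfadjoint_eigenvector[OF T sa less.prems False] by blast
    have vv: "v \<bullet> v = 1" using v by (simp add: norm_eq_1)
    define W where "W = {w \<in> U. v \<bullet> w = 0}"
    have sW: "subspace W"
      using less.prems(1) by (auto simp: W_def subspace_def inner_simps)
    have "T ` W \<subseteq> W"
      using less.prems(2) v by (auto simp: W_def simp flip: sa)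
    moreover have "dim W < dim U"
    proof -
      have "span W \<subset> span U"
        unfolding span_eq_iff[THEN iffD2, OF sW] span_eq_iff[THEN iffD2, OF less.prems(1)]
        using v(1) vv by (force simp: W_def)
      then show ?thesis by (rule dim_psubset)
    qed
    ultimately obtain B c where B: "finite B" "pairwise orthogonal B"
        "\<And>b. b \<in> B \<Longrightarrow> norm b = 1 \<and> T b = c b *\<^sub>R b" "span B = W"
      using less.hyps[of W] sW by blast
    have BW: "B \<subseteq> W" using B(4) span_superset by blast
    then have "v \<notin> B" using vv by (auto simp: W_def)
    have "span (insert v B) = U"
    proof
      show "span (insert v B) \<subseteq> U"
        using BW v less.prems(1) by (intro span_minimal) (auto simp: W_def)
      show "U \<subseteq> span (insert v B)"
      proof
        fix w assume "w \<in> U"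
        then have "w - (v \<bullet> w) *\<^sub>R v \<in> span B"
          using v vv less.prems(1) unfolding B(4)
          by (simp add: W_def inner_simps subspace_diff subspace_scale)
        then show "w \<in> span (insert v B)" using span_breakdown_eq by blast
      qed
    qed
    moreover have "pairwise orthogonal (insert v B)"
      using B(2) BW by (auto simp: pairwise_insert orthogonal_def W_def inner_commute)
    ultimately show ?thesis
      using B v \<open>v \<notin> B\<close> by (intro exI[of _ "insert v B"] exI[of _ "c(v := a)"]) auto
  qed
qed

text \<open>Each eigenvalue is replaced by its square root in an orthonormal eigenbasis.\<close>

lemma psd_sqrt_exists:
  fixes T :: "'a::euclidean_space \<Rightarrow> 'a"
  assumes T: "linear T" and sa: "\<And>v w. T v \<bullet> w = v \<bullet> T w" and psd: "\<And>v. 0 \<le> T v \<bullet> v"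
  shows "\<exists>S. linear S \<and> adjoint S = S \<and> (\<forall>v. 0 \<le> S v \<bullet> v) \<and> S \<circ> S = T"
proof -
  obtain B c where B: "finite B" "pairwise orthogonal B"
      "\<And>b. b \<in> B \<Longrightarrow> norm b = 1" "\<And>b. b \<in> B \<Longrightarrow> T b = c b *\<^sub>R b" "span B = UNIV"
    using selfadjoint_eigenbasis[OF T sa, of UNIV] by auto
  have bb: "b \<bullet> b' = (if b = b' then 1 else 0)" if "b \<in> B" "b' \<in> B" for b b'
    using B(2,3) that by (auto simp: pairwise_def orthogonal_def norm_eq_1)
  have c: "0 \<le> c b" if "b \<in> B" for b
    using psd[of b] B(4)[OF that] bb[OF that that] by simp
  define S where "S v = (\<Sum>b\<in>B. sqrt (c b) *\<^sub>R ((v \<bullet> b) *\<^sub>R b))" for v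
  have lin: "linear S"
    unfolding S_def
    by (auto intro!: linearI simp: inner_simps scaleR_add_left scaleR_add_right sum.distrib scaleR_sum_right distrib_left mult.left_commute)
  have Sb: "S b = sqrt (c b) *\<^sub>R b" if "b \<in> B" for b
  proof -
    have "S b = (\<Sum>b'\<in>B. if b' = b then sqrt (c b) *\<^sub>R b else 0)"
      unfolding S_def using bb that by (intro sum.cong) auto
    then show ?thesis using that B(1) by simp
  qed
  have "S \<circ> S = T"
  proof
    fix v
    have "v \<in> span B" using B(5) by simp
    then show "(S \<circ> S) v = T v"
      by (rule linear_eq_on[OF linear_compose[OF lin lin] T])
        (simp add: Sb linear_cmul[OF lin] B(4) c)
  qed
  moreover have "adjoint S = S"
    by (intro adjoint_unique) (simp add: S_def inner_sum_left inner_sum_right inner_commute ac_simps)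
  moreover have "0 \<le> S v \<bullet> v" for v
    unfolding S_def inner_sum_left by (intro sum_nonneg) (simp add: c inner_commute[of _ v] mult.assoc)
  ultimately show ?thesis using lin by blast
qed

text \<open>Diagonalize the difference \<open>D = A - B\<close>. Since
  \<open>A D + D B = A^2 - B^2 = 0\<close>, an eigenvalue of \<open>D\<close> annihilates the sum of
  two nonnegative numbers whose difference it is, so it vanishes.\<close>

lemma psd_sqrt_unique:
  fixes A B :: "'a::euclidean_space \<Rightarrow> 'a"
  assumes A: "linear A" "adjoint A = A" "\<And>v. 0 \<le> A v \<bullet> v"
    and B: "linear B" "adjoint B = B" "\<And>v. 0 \<le> B v \<bullet> v"
    and eq: "A \<circ> A = B \<circ> B"
  shows "A = B"
proof -
  have saA: "A v \<bullet> w = v \<bullet> A w" and saB: "B v \<bullet> w = v \<bullet> B w" for v w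
    using adjoint_works[OF A(1), of w v] adjoint_works[OF B(1), of w v] A(2) B(2)
    by (simp_all add: inner_commute)
  define D where "D v = A v - B v" for v
  have D: "linear D" unfolding D_def by (intro linear_compose_sub A B)
  have saD: "D v \<bullet> w = v \<bullet> D w" for v w by (simp add: D_def inner_simps saA saB)
  obtain E c where E: "\<And>b. b \<in> E \<Longrightarrow> norm b = 1" "\<And>b. b \<in> E \<Longrightarrow> D b = c b *\<^sub>R b"
      "span E = UNIV"
    using selfadjoint_eigenbasis[OF D saD, of UNIV] by auto
  have "D b = 0" if "b \<in> E" for b
  proof -
    have "b \<bullet> (A (D b) + D (B b)) = 0"
      using fun_cong[OF eq, of b] by (simp add: D_def linear_diff[OF A(1)])
    moreover have "b \<bullet> A (D b) = c b * (A b \<bullet> b)" "b \<bullet> D (B b) = c b * (B b \<bullet> b)"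
      using E(2)[OF that] by (simp_all add: linear_cmul[OF A(1)] inner_commute flip: saD)
    ultimately have z: "c b * (A b \<bullet> b + B b \<bullet> b) = 0" by (simp add: inner_simps algebra_simps)
    have "c b = A b \<bullet> b - B b \<bullet> b"
      using E(1)[OF that] arg_cong[OF E(2)[OF that], of "\<lambda>w. w \<bullet> b"]
      by (simp add: D_def inner_simps norm_eq_1)
    with z A(3)[of b] B(3)[of b] have "c b = 0" by (auto simp: add_nonneg_eq_0_iff)
    then show ?thesis using E(2)[OF that] by simp
  qed
  then have "D v = 0" for v
    using linear_eq_on[OF D linear_zero, of v E] E(3) by simp
  then show ?thesis by (auto simp: D_def)
qed

lemma psd_sqrt:
  fixes T :: "'a::euclidean_space \<Rightarrow> 'a"
  assumes "linear T" "\<And>v w. T v \<bullet> w = v \<bullet> T w" "\<And>v. 0 \<le> T v \<bullet> v"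
  shows "linear (psd_sqrt T)" "adjoint (psd_sqrt T) = psd_sqrt T" "psd_sqrt T (psd_sqrt T v) = T v"
proof -
  let ?P = "\<lambda>S. linear S \<and> adjoint S = S \<and> (\<forall>v. 0 \<le> S v \<bullet> v) \<and> S \<circ> S = T"
  have "\<exists>!S. ?P S"
    using psd_sqrt_exists[of T] assms by (auto intro: psd_sqrt_unique)
  then have "?P (psd_sqrt T)" unfolding psd_sqrt_def by (rule theI')
  then show "linear (psd_sqrt T)" "adjoint (psd_sqrt T) = psd_sqrt T" "psd_sqrt T (psd_sqrt T v) = T v"
    by (auto simp: fun_eq_iff)
qed

subsection \<open>Quadratic dual problems over a compact convex set\<close>

text \<open>On a short segment from \<open>q\<close> towards \<open>q'\<close> the linear term
  dominates the quadratic one. The quadratic upper bound takes the place of differentiability of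
  \<open>F\<close>.\<close>

lemma minimizer_variational_ineq:
  fixes q :: "'a::real_inner"
  assumes "convex C" "q \<in> C" "q' \<in> C"
    and min: "\<And>y. y \<in> C \<Longrightarrow> F q \<le> F y"
    and le: "\<And>y. y \<in> C \<Longrightarrow> F y \<le> F q + g \<bullet> (y - q) + c * (norm (y - q))\<^sup>2"
  shows "0 \<le> g \<bullet> (q' - q)"
proof (rule ccontr)
  define a b where "a = g \<bullet> (q' - q)" and "b = \<bar>c * (norm (q' - q))\<^sup>2\<bar> + 1"
  assume "\<not> 0 \<le> g \<bullet> (q' - q)"
  then have a: "a < 0" by (simp add: a_def)
  have b: "b > 0" "c * (norm (q' - q))\<^sup>2 \<le> b" by (auto simp: b_def)
  \<comment> \<open>\<open>t \<le> 1\<close> keeps the point in \<open>C\<close>, and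
    \<open>t * b \<le> - a / 2\<close> lets the quadratic error consume at most half of the linear
    decrease.\<close>
  define t where "t = min 1 (- a / (2 * b))"
  have t: "0 < t" "t \<le> 1" "t * b \<le> - a / 2"
    using a b by (auto simp: t_def min_def field_simps)
  have "(1 - t) *\<^sub>R q + t *\<^sub>R q' \<in> C"
    using assms(1-3) t by (intro convexD) auto
  moreover have "(1 - t) *\<^sub>R q + t *\<^sub>R q' = q + t *\<^sub>R (q' - q)" by (simp add: algebra_simps)
  ultimately have y: "q + t *\<^sub>R (q' - q) \<in> C" by simp
  have "0 \<le> t * a + c * (t * norm (q' - q))\<^sup>2"
    using min[OF y] le[OF y] t by (simp add: a_def)
  also have "\<dots> = t * (a + t * (c * (norm (q' - q))\<^sup>2))"
    by (simp add: power2_eq_square algebra_simps)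
  finally have "0 \<le> a + t * (c * (norm (q' - q))\<^sup>2)" using t by (simp add: zero_le_mult_iff)
  also have "\<dots> \<le> a + t * b" using b t by (intro add_left_mono mult_left_mono) auto
  also have "\<dots> < 0" using t a by simp
  finally show False by simp
qed

text \<open>Subtracting the accumulated errors leaves a decreasing sequence that is bounded
  below.\<close>

lemma convergent_quasi_decreasing:
  fixes a e :: "nat \<Rightarrow> real"
  assumes "\<And>k. 0 \<le> a k" "\<And>k. 0 \<le> e k" "summable e" "\<And>k. a (Suc k) \<le> a k + e k"
  shows "convergent a"
proof -
  define b where "b k = a k - sum e {..<k}" for k
  have "decseq b" using assms(4) by (intro decseq_SucI) (simp add: b_def algebra_simps)
  moreover have "- suminf e \<le> b k" for k
    using sum_le_suminf[OF assms(3), of "{..<k}"] assms(1)[of k] assms(2) by (simp add: b_def)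
  ultimately have "convergent b" using decseq_convergent convergentI by metis
  moreover have "convergent (\<lambda>k. sum e {..<k})" using assms(3) by (simp add: summable_iff_convergent)
  ultimately have "convergent (\<lambda>k. b k + sum e {..<k})" by (rule convergent_add)
  then show ?thesis by (simp add: b_def)
qed

lemma norm_triple_le:
  fixes a :: "'a::real_normed_vector" and b :: "'b::real_normed_vector" and c :: "'c::real_normed_vector"
  shows "norm (a, b, c) \<le> norm (a, b) + norm c"
proof -
  have "norm (a, b, c) \<le> norm (a, b, 0 :: 'c) + norm (0 :: 'a, 0 :: 'b, c)"
    using norm_triangle_ineq[of "(a, b, 0)" "(0, 0, c)"] by simp
  then show ?thesis by (simp add: norm_Pair)
qed

lemma norm_Pair_le_triple: "norm (a, b) \<le> norm (a, b, c)"
  by (simp add: norm_Pair)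

text \<open>\<open>C_iff\<close> and \<open>h_attained\<close> say that \<open>h\<close> is the
  support function of \<open>C\<close>. In the total variation model \<open>G\<close> is the
  gradient, \<open>C\<close> the box and \<open>h\<close> the weighted 1-norm.\<close>

locale dual_qp =
  fixes H :: "'x::euclidean_space \<Rightarrow> 'x" and G :: "'x \<Rightarrow> 'y::euclidean_space" and f :: 'x
    and C :: "'y set" and h :: "'y \<Rightarrow> real"
  assumes linear_H: "linear H" and sym_H: "H v \<bullet> w = v \<bullet> H w"
    and pos_H: "v \<noteq> 0 \<Longrightarrow> 0 < H v \<bullet> v"
    and linear_G: "linear G"
    and bounded_C: "bounded C" and C_iff: "q \<in> C \<longleftrightarrow> (\<forall>p. q \<bullet> p \<le> h p)"
    and h_attained: "\<exists>q\<in>C. q \<bullet> p = h p"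
begin

text \<open>The minimizer in \<open>u\<close> of the Lagrangian with multiplier \<open>q\<close>,
  that is, the solution of \<open>H u + adjoint G q = f\<close>.\<close>

definition pr where "pr q = inv H (f - adjoint G q)"

text \<open>Smooth part of the dual objective: half the squared norm of
  \<open>f - adjoint G q\<close> in the metric of \<open>inv H\<close>. Its gradient is
  \<open>- G (pr q)\<close>.\<close>

definition Q where "Q q = inv H (f - adjoint G q) \<bullet> (f - adjoint G q) / 2"

text \<open>Membership of \<open>v\<close> in the subdifferential of the dual objective, as a
  variational inequality: \<open>v + G (pr q)\<close> is normal to \<open>C\<close> at
  \<open>q\<close>.\<close>

definition dual_sub where
  "dual_sub v q \<longleftrightarrow> q \<in> C \<and> (\<forall>q'\<in>C. (v + G (pr q)) \<bullet> (q' - q) \<le> 0)"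

definition prox where "prox s x = (SOME q. dual_sub ((1 / s) *\<^sub>R (x - q)) q)"

lemma C_eq: "C = (\<Inter>p. {q. p \<bullet> q \<le> h p})"
  using C_iff by (auto simp: inner_commute)

lemma convex_C: "convex C"
  unfolding C_eq by (intro convex_INT convex_halfspace_le)

lemma closed_C: "closed C"
  unfolding C_eq by (intro closed_INT ballI closed_halfspace_le)

lemma compact_C: "compact C"
  using closed_C bounded_C by (simp add: compact_eq_bounded_closed)

lemma nonempty_C: "C \<noteq> {}" using h_attained by blast

lemma energy_nonneg: "0 \<le> H v \<bullet> v"
  using pos_H[of v] by (cases "v = 0") auto

lemma linear_adj: "linear (adjoint G)"
  using linear_G by (rule adjoint_linear)

lemma adj: "adjoint G q \<bullet> v = q \<bullet> G v" "v \<bullet> adjoint G q = G v \<bullet> q"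
  using adjoint_works[OF linear_G, of v q] by (simp_all add: inner_commute)

lemma inj_H: "inj H"
proof -
  have "v = 0" if "H v = 0" for v using pos_H[of v] that by auto
  then show ?thesis using linear_injective_0[OF linear_H] by blast
qed

lemma bij_H: "bij H"
  using inj_H linear_injective_imp_surjective[OF linear_H] by (auto simp: bij_def)

lemma H_inv: "H (inv H y) = y"
  using bij_H by (simp add: bij_is_surj surj_f_inv_f)

lemma linear_inv: "linear (inv H)"
proof -
  obtain g where g: "linear g" "g \<circ> H = id"
    using linear_injective_left_inverse[OF linear_H inj_H] by blast
  then have "inv H = g" by (intro inv_unique_comp) (use bij_H H_inv in \<open>auto simp: fun_eq_iff\<close>, metis H_inv)
  then show ?thesis using g by simp
qed

lemma sym_inv: "inv H v \<bullet> w = v \<bullet> inv H w"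
  using sym_H[of "inv H v" "inv H w"] by (simp add: H_inv)

lemma inv_nonneg: "0 \<le> inv H v \<bullet> v"
  using energy_nonneg[of "inv H v"] by (simp add: H_inv inner_commute)

lemma H_pr: "H (pr q) = f - adjoint G q"
  by (simp add: pr_def H_inv)

lemma pr_eqI: "H u = f - adjoint G q \<Longrightarrow> u = pr q"
  using inj_H by (metis H_pr injD)

lemma pr_diff: "pr q' - pr q = - inv H (adjoint G (q' - q))"
  by (simp add: pr_def linear_diff[OF linear_inv] linear_diff[OF linear_adj])

lemma continuous_pr: "continuous_on A pr"
  unfolding pr_def
  by (intro linear_continuous_on_compose[OF _ linear_inv] continuous_intros
      linear_continuous_on_compose[OF continuous_on_id linear_adj])

lemma tendsto_pr: "q \<longlonglongrightarrow> q' \<Longrightarrow> (\<lambda>k. pr (q k)) \<longlonglongrightarrow> pr q'"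
  using continuous_pr[of UNIV] by (intro isCont_tendsto_compose[of _ pr]) (auto simp: continuous_on_eq_continuous_at)

lemma tendsto_G: "v \<longlonglongrightarrow> v' \<Longrightarrow> (\<lambda>k. G (v k)) \<longlonglongrightarrow> G v'"
  by (rule bounded_linear.tendsto[OF linear_G[unfolded linear_conv_bounded_linear]])

lemma Q_eq: "Q q = H (pr q) \<bullet> pr q / 2"
  unfolding H_pr by (simp add: Q_def pr_def inner_commute)

text \<open>\<open>Q\<close> is quadratic, so its Taylor expansion stops at second order; the
  remainder is half the \<open>H\<close>-energy of the displacement of the primal point.\<close>

lemma Q_expand:
  "Q q' = Q q - G (pr q) \<bullet> (q' - q) + H (pr q' - pr q) \<bullet> (pr q' - pr q) / 2"
proof -
  have "H (pr q' - pr q) \<bullet> (pr q' - pr q)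
      = H (pr q') \<bullet> pr q' + H (pr q) \<bullet> pr q - 2 * (pr q \<bullet> H (pr q'))"
    using sym_H[of "pr q" "pr q'"]
    by (simp add: linear_diff[OF linear_H] inner_simps inner_commute)
  moreover have "pr q \<bullet> H (pr q') = H (pr q) \<bullet> pr q - G (pr q) \<bullet> (q' - q)"
    unfolding H_pr by (simp add: inner_simps adj inner_commute)
  ultimately show ?thesis by (simp add: Q_eq field_simps)
qed

text \<open>The remainder of \<open>Q_expand\<close> involves only bounded linear maps of
  \<open>q' - q\<close>. The result is the quadratic bound that
  \<open>minimizer_variational_ineq\<close> asks for.\<close>

lemma Q_upper: "\<exists>c\<ge>0. \<forall>q q'. Q q' \<le> Q q - G (pr q) \<bullet> (q' - q) + c * (norm (q' - q))\<^sup>2"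
proof -
  have "bounded_linear (\<lambda>e. inv H (adjoint G e))" "bounded_linear (adjoint G)"
    using linear_compose[OF linear_adj linear_inv] linear_adj
    by (simp_all add: o_def linear_conv_bounded_linear)
  then obtain b1 b2 where b: "b1 > 0" "b2 > 0" "\<And>e. norm (inv H (adjoint G e)) \<le> norm e * b1"
      "\<And>e. norm (adjoint G e) \<le> norm e * b2"
    using bounded_linear.pos_bounded by metis
  have "Q q' \<le> Q q - G (pr q) \<bullet> (q' - q) + (b1 * b2 / 2) * (norm (q' - q))\<^sup>2" for q q'
  proof -
    define e where "e = q' - q"
    have "H (pr q' - pr q) \<bullet> (pr q' - pr q) = adjoint G e \<bullet> inv H (adjoint G e)"
      unfolding pr_diff e_def by (simp add: linear_neg[OF linear_H] H_inv)
    also have "\<dots> \<le> (norm e * b2) * (norm e * b1)"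
      using b by (intro order_trans[OF norm_cauchy_schwarz] mult_mono) auto
    finally show ?thesis using Q_expand[of q' q] by (simp add: e_def power2_eq_square algebra_simps)
  qed
  then show ?thesis using b by (intro exI[of _ "b1 * b2 / 2"]) simp
qed

text \<open>One direction drops the nonnegative remainder in \<open>Q_expand\<close>; the other is
  the first-order condition for minimizing \<open>Q y - v \<bullet> y\<close> over
  \<open>C\<close>.\<close>

lemma dual_sub_iff:
  "dual_sub v q \<longleftrightarrow> q \<in> C \<and> (\<forall>q'\<in>C. Q q + v \<bullet> (q' - q) \<le> Q q')"
proof (intro iffI conjI ballI)
  assume d: "dual_sub v q"
  then show "q \<in> C" by (simp add: dual_sub_def)
  fix q' assume "q' \<in> C"
  then have "(v + G (pr q)) \<bullet> (q' - q) \<le> 0" using d by (simp add: dual_sub_def)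
  then show "Q q + v \<bullet> (q' - q) \<le> Q q'"
    using energy_nonneg[of "pr q' - pr q"] Q_expand[of q' q] unfolding inner_add_left by linarith
next
  assume d: "q \<in> C \<and> (\<forall>q'\<in>C. Q q + v \<bullet> (q' - q) \<le> Q q')"
  obtain c where c: "\<And>q'. Q q' \<le> Q q - G (pr q) \<bullet> (q' - q) + c * (norm (q' - q))\<^sup>2"
    using Q_upper by blast
  have "0 \<le> (- (v + G (pr q))) \<bullet> (q' - q)" if "q' \<in> C" for q'
  proof (rule minimizer_variational_ineq[OF convex_C _ that, where F = "\<lambda>y. Q y - v \<bullet> y"])
    show "q \<in> C" using d by blast
    show "Q q - v \<bullet> q \<le> Q y - v \<bullet> y" if "y \<in> C" for y
      using d that by (auto simp: inner_simps)
    show "Q y - v \<bullet> y \<le> Q q - v \<bullet> q + (- (v + G (pr q))) \<bullet> (y - q) + c * (norm (y - q))\<^sup>2" for y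
      using c[of y] by (simp add: inner_simps)
  qed
  then show "dual_sub v q" using d unfolding dual_sub_def inner_minus_left by auto
qed

lemma subdiff_dual:
  "subdiff (\<lambda>q. ereal (Q q - a) + cvx_ind C q) q = {v. dual_sub v q}"
proof -
  have "(v \<in> subdiff (\<lambda>q. ereal (Q q - a) + cvx_ind C q) q) = dual_sub v q" for v
    by (cases "q \<in> C") (auto simp: subdiff_def cvx_ind_def dual_sub_iff algebra_simps)
  then show ?thesis by blast
qed

lemma minimizers_dual:
  "{q. \<forall>q'. ereal (Q q - a) + cvx_ind C q \<le> ereal (Q q' - a) + cvx_ind C q'} = {q. dual_sub 0 q}"
proof -
  \<comment> \<open>A feasible point has finite value, which excludes minimizers outside
    \<open>C\<close>.\<close>
  obtain q0 where "q0 \<in> C" using nonempty_C by blast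
  then have "(\<forall>q'. ereal (Q q - a) + cvx_ind C q \<le> ereal (Q q' - a) + cvx_ind C q') = dual_sub 0 q" for q
    by (cases "q \<in> C") (auto simp: cvx_ind_def dual_sub_iff)
  then show ?thesis by blast
qed

section \<open>Proximal map and solutions of the dual problem\<close>

lemma continuous_Q: "continuous_on A Q"
  unfolding Q_eq[abs_def]
  by (intro continuous_intros continuous_pr linear_continuous_on_compose[OF continuous_pr linear_H]) simp

text \<open>The inclusion is the first-order condition for minimizing \<open>?F\<close>, the dual
  objective with a proximal term, over the compact set \<open>C\<close>.\<close>

lemma prox_works:
  assumes "0 < s"
  shows "dual_sub ((1 / s) *\<^sub>R (x - prox s x)) (prox s x)"
proof -
  let ?F = "\<lambda>y. Q y + (norm (y - x))\<^sup>2 / (2 * s)"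
  have "continuous_on C ?F" using assms by (intro continuous_intros continuous_Q) auto
  then obtain q where q: "q \<in> C" "\<And>y. y \<in> C \<Longrightarrow> ?F q \<le> ?F y"
    using continuous_attains_inf[OF compact_C nonempty_C, of ?F] by blast
  obtain c where c: "\<And>q'. Q q' \<le> Q q - G (pr q) \<bullet> (q' - q) + c * (norm (q' - q))\<^sup>2"
    using Q_upper by blast
  have "0 \<le> (- ((1 / s) *\<^sub>R (x - q) + G (pr q))) \<bullet> (q' - q)" if "q' \<in> C" for q'
  proof (rule minimizer_variational_ineq[OF convex_C q(1) that, where F = ?F])
    show "?F q \<le> ?F y" if "y \<in> C" for y using q(2) that .
    fix y
    have "(norm (y - x))\<^sup>2 = (norm (q - x))\<^sup>2 - 2 * ((x - q) \<bullet> (y - q)) + (norm (y - q))\<^sup>2"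
      by (simp add: power2_norm_eq_inner inner_simps inner_commute)
    then have "(norm (y - x))\<^sup>2 / (2 * s)
        = (norm (q - x))\<^sup>2 / (2 * s) - (1 / s) * ((x - q) \<bullet> (y - q)) + 1 / (2 * s) * (norm (y - q))\<^sup>2"
      using assms by (simp add: field_simps)
    then show "?F y \<le> ?F q + (- ((1 / s) *\<^sub>R (x - q) + G (pr q))) \<bullet> (y - q)
        + (c + 1 / (2 * s)) * (norm (y - q))\<^sup>2"
      using c[of y] by (simp add: inner_add_left inner_diff_left algebra_simps)
  qed
  then have "dual_sub ((1 / s) *\<^sub>R (x - q)) q"
    using q(1) unfolding dual_sub_def inner_minus_left by auto
  then show ?thesis unfolding prox_def by (rule someI)
qed

lemma dual_sub_zero_exists: "\<exists>q. dual_sub 0 q"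
  using continuous_attains_inf[OF compact_C nonempty_C continuous_Q] by (auto simp: dual_sub_iff)

text \<open>Adding the two variational inequalities gives monotonicity, sharpened by the
  \<open>H\<close>-energy of the difference of the primal points. Hence all dual solutions share one
  primal point.\<close>

lemma dual_sub_mono:
  assumes "dual_sub v q" "dual_sub v' q'"
  shows "H (pr q - pr q') \<bullet> (pr q - pr q') \<le> (v - v') \<bullet> (q - q')"
proof -
  have "(v + G (pr q)) \<bullet> (q' - q) \<le> 0" "(v' + G (pr q')) \<bullet> (q - q') \<le> 0"
    using assms by (auto simp: dual_sub_def)
  moreover have "H (pr q - pr q') \<bullet> (pr q - pr q') = (G (pr q) - G (pr q')) \<bullet> (q' - q)"
    unfolding linear_diff[OF linear_H] H_pr by (simp add: inner_simps adj inner_commute)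
  ultimately show ?thesis by (simp add: inner_simps)
qed

lemma pr_unique:
  assumes "dual_sub 0 q" "dual_sub 0 q'"
  shows "pr q = pr q'"
  using dual_sub_mono[OF assms] pos_H[of "pr q - pr q'"] by fastforce

text \<open>By the variational inequality \<open>q\<close> maximizes the functional
  \<open>v + G (pr q)\<close> over \<open>C\<close>, and this maximum is the support
  function.\<close>

lemma dual_sub_support:
  assumes "dual_sub v q"
  shows "q \<bullet> (v + G (pr q)) = h (v + G (pr q))"
proof -
  obtain q' where "q' \<in> C" "q' \<bullet> (v + G (pr q)) = h (v + G (pr q))" using h_attained by blast
  moreover have "q \<bullet> (v + G (pr q)) \<le> h (v + G (pr q))"
    using assms C_iff by (simp add: dual_sub_def)
  moreover have "(v + G (pr q)) \<bullet> (q' - q) \<le> 0" using assms \<open>q' \<in> C\<close> by (simp add: dual_sub_def)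
  ultimately show ?thesis by (simp add: inner_simps inner_commute)
qed

lemma dual_subI:
  assumes "q \<in> C" "q \<bullet> (v + G (pr q)) = h (v + G (pr q))"
  shows "dual_sub v q"
proof -
  have "(v + G (pr q)) \<bullet> (q' - q) \<le> 0" if "q' \<in> C" for q'
  proof -
    have "(v + G (pr q)) \<bullet> (q' - q) = q' \<bullet> (v + G (pr q)) - q \<bullet> (v + G (pr q))"
      by (metis inner_diff_left inner_commute)
    then show ?thesis using that C_iff assms(2) by simp
  qed
  then show ?thesis using assms(1) by (simp add: dual_sub_def)
qed

lemma dual_sub_closed:
  assumes "\<And>k::nat. dual_sub (v k) (q k)" "v \<longlonglongrightarrow> v'" "q \<longlonglongrightarrow> q'"
  shows "dual_sub v' q'"
  unfolding dual_sub_def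
proof (intro conjI ballI)
  show "q' \<in> C"
    using closed_C assms by (metis closed_sequentially dual_sub_def)
  fix y assume y: "y \<in> C"
  have "(\<lambda>k. (v k + G (pr (q k))) \<bullet> (y - q k)) \<longlonglongrightarrow> (v' + G (pr q')) \<bullet> (y - q')"
    by (intro tendsto_intros tendsto_G tendsto_pr assms)
  then show "(v' + G (pr q')) \<bullet> (y - q') \<le> 0"
    by (rule LIMSEQ_le_const2) (use assms(1) y in \<open>auto simp: dual_sub_def\<close>)
qed

text \<open>Monotonicity makes the inner product of \<open>x - prox s x\<close> and
  \<open>prox s x - q\<close> nonnegative; expanding the squared norm of their sum gives the
  bound.\<close>

lemma prox_firm:
  assumes "0 < s" "dual_sub 0 q"
  shows "(norm (prox s x - q))\<^sup>2 + (norm (x - prox s x))\<^sup>2 \<le> (norm (x - q))\<^sup>2"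
proof -
  let ?y = "prox s x"
  have "0 \<le> ((1 / s) *\<^sub>R (x - ?y) - 0) \<bullet> (?y - q)"
    using dual_sub_mono[OF prox_works[OF assms(1)] assms(2)] energy_nonneg order_trans by blast
  then have "0 \<le> (x - ?y) \<bullet> (?y - q)" using assms(1) by (simp add: zero_le_divide_iff)
  moreover have "(norm (x - q))\<^sup>2 = (norm (?y - q))\<^sup>2 + (norm (x - ?y))\<^sup>2 + 2 * ((x - ?y) \<bullet> (?y - q))"
    by (simp add: power2_norm_eq_inner inner_simps inner_commute)
  ultimately show ?thesis by simp
qed

section \<open>The augmented Lagrangian\<close>

definition Phi where
  "Phi a s q = (\<lambda>(u, p). H u \<bullet> u / 2 - f \<bullet> u + a + h p + q \<bullet> (G u - p) + s / 2 * (norm (G u - p))\<^sup>2)"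

text \<open>Apart from \<open>h\<close> everything is quadratic, so the expansion is exact, and its
  first-order coefficients contain the updated multiplier. The case \<open>s = 0\<close> serves to
  compare primal objective values.\<close>

lemma Phi_expand:
  "Phi a s q (u + du, p + dp) = Phi a s q (u, p)
     + (H u - f + adjoint G (q + s *\<^sub>R (G u - p))) \<bullet> du
     + (h (p + dp) - h p - (q + s *\<^sub>R (G u - p)) \<bullet> dp)
     + H du \<bullet> du / 2 + s / 2 * (norm (G du - dp))\<^sup>2"
proof -
  define r m where "r = G u - p" and "m = q + s *\<^sub>R r"
  have 1: "H (u + du) \<bullet> (u + du) = H u \<bullet> u + 2 * (H u \<bullet> du) + H du \<bullet> du"
    using sym_H[of u du] by (simp add: linear_add[OF linear_H] inner_simps inner_commute)
  have r: "G (u + du) - (p + dp) = r + (G du - dp)" by (simp add: r_def linear_add[OF linear_G])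
  have 2: "(norm (r + (G du - dp)))\<^sup>2
      = (norm r)\<^sup>2 + 2 * (r \<bullet> G du - r \<bullet> dp) + (norm (G du - dp))\<^sup>2"
    by (simp add: power2_norm_eq_inner inner_simps inner_commute)
  have 3: "(H u - f + adjoint G m) \<bullet> du = H u \<bullet> du - f \<bullet> du + (q \<bullet> G du + s * (r \<bullet> G du))"
    by (simp add: m_def adj inner_simps)
  have 4: "m \<bullet> dp = q \<bullet> dp + s * (r \<bullet> dp)" by (simp add: m_def inner_simps)
  have 5: "q \<bullet> (r + (G du - dp)) = q \<bullet> r + q \<bullet> G du - q \<bullet> dp" by (simp add: inner_simps)
  show ?thesis
    unfolding Phi_def prod.case r r_def[symmetric] m_def[symmetric] 1 2 3 4 5 inner_add_right[of f]
    by (simp add: field_simps)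
qed

text \<open>The partial minimality of \<open>p\<close> is not what makes the multiplier update an approximate proximal
  step: the gap of \<^const>\<open>Phi\<close> itself contains the squared distance of the new multiplier to the
  exact proximal point.\<close>

lemma Phi_gap:
  assumes s: "0 < s"
    and gap: "Phi a s q (u, p) - (INF w. Phi a s q w) \<le> e"
  defines "x \<equiv> prox s q"
  shows "H (u - pr x) \<bullet> (u - pr x) / 2 + (norm (q + s *\<^sub>R (G u - p) - x))\<^sup>2 / (2 * s) \<le> e"
proof -
  define v where "v = (1 / s) *\<^sub>R (q - x)"
  have d: "dual_sub v x" unfolding v_def x_def by (rule prox_works[OF s])
  \<comment> \<open>The \<open>p\<close>-component belonging to \<open>x\<close>: updating
    \<open>q\<close> at \<open>(pr x, ph)\<close> returns \<open>x\<close> itself.\<close>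
  define ph where "ph = v + G (pr x)"
  have sv: "q + s *\<^sub>R (G (pr x) - ph) = x" using s by (simp add: ph_def v_def)
  \<comment> \<open>Expand at \<open>(pr x, ph)\<close>: the linear term in \<open>u\<close>
    vanishes by the equation for \<open>pr x\<close>, and the term in \<open>p\<close> is
    nonnegative because \<open>x\<close> is a subgradient of \<open>h\<close> at
    \<open>ph\<close>.\<close>
  have key: "Phi a s q (pr x, ph) + H (u - pr x) \<bullet> (u - pr x) / 2
      + (norm (q + s *\<^sub>R (G u - p) - x))\<^sup>2 / (2 * s) \<le> Phi a s q (u, p)" for u p
  proof -
    have "h p - h ph - x \<bullet> (p - ph) \<ge> 0"
      using dual_sub_support[OF d] d C_iff by (simp add: ph_def dual_sub_def inner_simps)
    moreover have eq: "q + s *\<^sub>R (G u - p) - x = s *\<^sub>R (G (u - pr x) - (p - ph))"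
      using sv by (simp add: linear_diff[OF linear_G] algebra_simps)
    have "(norm (q + s *\<^sub>R (G u - p) - x))\<^sup>2 / (2 * s) = s / 2 * (norm (G (u - pr x) - (p - ph)))\<^sup>2"
      unfolding eq using s by (simp add: power_mult_distrib power2_eq_square[of s])
    ultimately show ?thesis
      using Phi_expand[of a s q "pr x" "u - pr x" ph "p - ph"] sv by (simp add: H_pr)
  qed
  \<comment> \<open>This also bounds \<open>Phi\<close> from below, as the real-valued infimum
    requires.\<close>
  have "Phi a s q (pr x, ph) \<le> Phi a s q w" for w
    using key[of "fst w" "snd w"] energy_nonneg[of "fst w - pr x"] s
    by (smt (verit) divide_nonneg_nonneg prod.collapse zero_le_power2)
  then have "(INF w. Phi a s q w) \<le> Phi a s q (pr x, ph)"
    by (intro cINF_lower bdd_belowI2) auto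
  then show ?thesis using key[of u p] gap by linarith
qed

section \<open>Support function, exposed faces and subdifferentials\<close>

lemma h_scale: "0 \<le> t \<Longrightarrow> h (t *\<^sub>R p) = t * h p"
proof (rule antisym)
  assume t: "0 \<le> t"
  obtain q where "q \<in> C" "q \<bullet> (t *\<^sub>R p) = h (t *\<^sub>R p)" using h_attained by blast
  then show "h (t *\<^sub>R p) \<le> t * h p" using t C_iff by (auto intro!: mult_left_mono simp flip: \<open>_ = h _\<close>)
  obtain q where "q \<in> C" "q \<bullet> p = h p" using h_attained by blast
  then show "t * h p \<le> h (t *\<^sub>R p)" using C_iff by (metis inner_scaleR_right)
qed

lemma h_add: "h (p + p') \<le> h p + h p'"
proof -
  obtain q where "q \<in> C" "q \<bullet> (p + p') = h (p + p')" using h_attained by blast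
  then show ?thesis using C_iff by (metis add_mono inner_add_right)
qed

definition face where "face p = {g \<in> C. g \<bullet> p = h p}"

text \<open>Testing \<open>d = p\<close> and \<open>d = - p\<close> with homogeneity of
  \<open>h\<close> settles \<open>g \<bullet> p = h p\<close>; subadditivity then removes the base
  point.\<close>

lemma faceI:
  assumes "\<And>d. g \<bullet> d \<le> h (p + d) - h p"
  shows "g \<in> face p"
proof -
  have "g \<bullet> p \<le> h p" using assms[of p] h_scale[of 2 p] by (simp add: scaleR_2)
  moreover have "h p \<le> g \<bullet> p" using assms[of "- p"] h_scale[of 0 p] by simp
  moreover have "g \<bullet> d \<le> h d" for d using assms[of d] h_add[of p d] by linarith
  ultimately show ?thesis using C_iff by (auto simp: face_def intro: antisym)
qed

lemma face_ineq: "g \<in> face p \<Longrightarrow> g \<bullet> d \<le> h (p + d) - h p"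
proof -
  assume "g \<in> face p"
  then have "g \<bullet> p = h p" "g \<bullet> (p + d) \<le> h (p + d)" using C_iff by (simp_all add: face_def del: inner_add_right)
  then show ?thesis by (simp add: inner_add_right)
qed

lemma subdiff_h: "subdiff (\<lambda>p. ereal (h p)) p = face p"
proof (intro equalityI subsetI)
  fix g assume g: "g \<in> subdiff (\<lambda>p. ereal (h p)) p"
  have "g \<bullet> d \<le> h (p + d) - h p" for d
  proof -
    have "ereal (h p) + ereal (g \<bullet> (p + d - p)) \<le> ereal (h (p + d))" using g unfolding subdiff_def by blast
    then show ?thesis by simp
  qed
  then show "g \<in> face p" by (rule faceI)
next
  fix g assume "g \<in> face p"
  then have "h p + g \<bullet> (y - p) \<le> h y" for y using face_ineq[of g p "y - p"] by simp
  then show "g \<in> subdiff (\<lambda>p. ereal (h p)) p" by (simp add: subdiff_def)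
qed

lemma face_nonempty: "face p \<noteq> {}"
  using h_attained by (auto simp: face_def)

lemma closed_face: "closed (face p)"
proof -
  have "face p = C \<inter> {g. p \<bullet> g = h p}" by (auto simp: face_def inner_commute)
  then show ?thesis using closed_C by (simp add: closed_Int closed_hyperplane)
qed

text \<open>In \<open>u\<close> the function is smooth, so a subgradient must equal the gradient; in
  \<open>p\<close> the quadratic penalty is of second order and contributes only through the
  multiplier \<open>q'\<close>.\<close>

lemma subdiff_Phi:
  fixes q u p
  assumes s: "0 < s"
  defines "q' \<equiv> q + s *\<^sub>R (G u - p)"
  shows "subdiff (\<lambda>w. ereal (Phi a s q w)) (u, p)
    = {H u - f + adjoint G (q')} \<times> (\<lambda>g. - q' + g) ` face p" (is "?L = ?R")
proof (intro equalityI subsetI)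
  fix w assume w: "w \<in> ?L"
  obtain v b where wv: "w = (v, b)" by fastforce
  have le: "Phi a s q (u, p) + (v \<bullet> du + b \<bullet> dp) \<le> Phi a s q (u + du, p + dp)" for du dp
  proof -
    have "ereal (Phi a s q (u, p)) + ereal ((v, b) \<bullet> ((u + du, p + dp) - (u, p)))
        \<le> ereal (Phi a s q (u + du, p + dp))"
      using w unfolding subdiff_def wv by blast
    then show ?thesis by simp
  qed
  define X where "X = H u - f + adjoint G q'"
  define d where "d = v - X"
  have dd: "d \<bullet> d = v \<bullet> d - X \<bullet> d" by (simp add: d_def inner_simps)
  \<comment> \<open>Test with \<open>t *\<^sub>R d\<close> in \<open>u\<close> alone, where
    \<open>d\<close> is the deviation of \<open>v\<close> from the gradient.\<close>
  have "0 \<le> 2 * t * (- (d \<bullet> d)) + t\<^sup>2 * (H d \<bullet> d + s * (norm (G d))\<^sup>2)" for t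
  proof -
    have "v \<bullet> (t *\<^sub>R d) \<le> X \<bullet> (t *\<^sub>R d) + H (t *\<^sub>R d) \<bullet> (t *\<^sub>R d) / 2 + s / 2 * (norm (G (t *\<^sub>R d)))\<^sup>2"
      using le[of "t *\<^sub>R d" 0] unfolding Phi_expand q'_def[symmetric] X_def[symmetric] by simp
    then have "t * (v \<bullet> d) \<le> t * (X \<bullet> d) + t\<^sup>2 * (H d \<bullet> d) / 2 + s / 2 * (t\<^sup>2 * (norm (G d))\<^sup>2)"
      by (simp add: linear_cmul[OF linear_H] linear_cmul[OF linear_G] power_mult_distrib power2_eq_square[of t])
    then show ?thesis unfolding dd by (simp add: algebra_simps)
  qed
  then have "- (d \<bullet> d) = 0" by (rule quadratic_nonneg_linear_zero)
  then have v: "v = H u - f + adjoint G q'" by (simp add: d_def X_def)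
  define g where "g = b + q'"
  have "g \<bullet> y \<le> h (p + y) - h p" for y
  proof -
    let ?c = "s / 2 * (norm y)\<^sup>2"
    \<comment> \<open>Convexity bounds the increment of \<open>h\<close> along
      \<open>t *\<^sub>R y\<close> by \<open>t\<close> times the full increment, while the penalty
      keeps a factor \<open>t\<close> after division by \<open>t\<close>.\<close>
    have "g \<bullet> y \<le> h (p + y) - h p + t * ?c" if t: "0 < t" "t < 1" for t
    proof -
      have "p + t *\<^sub>R y = (1 - t) *\<^sub>R p + t *\<^sub>R (p + y)" by (simp add: algebra_simps)
      then have "h (p + t *\<^sub>R y) \<le> (1 - t) * h p + t * h (p + y)"
        using h_add[of "(1 - t) *\<^sub>R p" "t *\<^sub>R (p + y)"] t by (simp add: h_scale)
      moreover have "b \<bullet> (t *\<^sub>R y) \<le> h (p + t *\<^sub>R y) - h p - q' \<bullet> (t *\<^sub>R y) + s / 2 * (norm (t *\<^sub>R y))\<^sup>2"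
        using le[of 0 "t *\<^sub>R y"] unfolding Phi_expand
        by (simp add: linear_0[OF linear_H] linear_0[OF linear_G] q'_def)
      ultimately have "t * (g \<bullet> y) \<le> t * (h (p + y) - h p + t * ?c)"
        by (simp add: g_def inner_simps power_mult_distrib power2_eq_square algebra_simps)
      then show ?thesis using t by simp
    qed
    moreover have "((\<lambda>t. h (p + y) - h p + t * ?c) \<longlongrightarrow> h (p + y) - h p + 0 * ?c) (at_right 0)"
      by (intro tendsto_intros)
    ultimately have "g \<bullet> y \<le> h (p + y) - h p + 0 * ?c"
      by (intro tendsto_lowerbound[of _ _ "at_right (0::real)"])
        (auto simp: eventually_at_right_field intro!: exI[of _ 1])
    then show ?thesis by simp
  qed
  then have "g \<in> face p" by (rule faceI)
  moreover have "b = - q' + g" by (simp add: g_def)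
  ultimately show "w \<in> ?R" unfolding wv v by blast
next
  fix w assume "w \<in> ?R"
  then obtain g where g: "g \<in> face p" and w: "w = (H u - f + adjoint G (q'), - q' + g)" by auto
  have "Phi a s q (u, p) + w \<bullet> (y - (u, p)) \<le> Phi a s q y" for y
  proof -
    define du dp where "du = fst y - u" and "dp = snd y - p"
    have y: "y = (u + du, p + dp)" by (simp add: du_def dp_def)
    have "w \<bullet> (y - (u, p)) = (H u - f + adjoint G q') \<bullet> du + (g \<bullet> dp - q' \<bullet> dp)"
      unfolding y w by (simp add: inner_diff_left)
    moreover have "0 \<le> s / 2 * (norm (G du - dp))\<^sup>2" using s by simp
    ultimately show ?thesis
      unfolding y Phi_expand q'_def[symmetric] using face_ineq[OF g, of dp] energy_nonneg[of du] by linarith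
  qed
  then show "w \<in> ?L" by (simp add: subdiff_def del: split_paired_All)
qed

text \<open>The constant is the minimum of the quadratic form on the compact unit sphere. It
  converts energy bounds into norm bounds.\<close>

lemma coercive: "\<exists>m>0. \<forall>v. m * (norm v)\<^sup>2 \<le> H v \<bullet> v"
proof -
  let ?S = "sphere 0 1 :: 'x set"
  have ne: "?S \<noteq> {}" by simp
  have "continuous_on ?S (\<lambda>v. H v \<bullet> v)"
    using linear_H by (intro continuous_intros linear_continuous_on) (simp add: linear_conv_bounded_linear)
  then obtain w where w: "w \<in> ?S" "\<And>v. v \<in> ?S \<Longrightarrow> H w \<bullet> w \<le> H v \<bullet> v"
    using continuous_attains_inf[of ?S "\<lambda>v. H v \<bullet> v"] ne by auto
  have "(H w \<bullet> w) * (norm v)\<^sup>2 \<le> H v \<bullet> v" for v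
  proof (cases "v = 0")
    case False
    then have "v /\<^sub>R norm v \<in> ?S" by simp
    from w(2)[OF this] have "H w \<bullet> w \<le> H v \<bullet> v / (norm v)\<^sup>2"
      by (simp add: linear_cmul[OF linear_H] divide_inverse power2_eq_square ac_simps)
    then show ?thesis using False by (simp add: pos_le_divide_eq)
  qed simp
  moreover have "0 < H w \<bullet> w" using w(1) by (intro pos_H) auto
  ultimately show ?thesis by blast
qed

section \<open>The KKT operator\<close>

definition kkt where
  "kkt = (\<lambda>(u, p, q). {H u - f + adjoint G q} \<times> (\<lambda>g. - q + g) ` face p \<times> {p - G u})"

lemma kkt_zeroD:
  assumes "0 \<in> kkt (u, p, q)"
  shows "dual_sub 0 q" "u = pr q" "p = G (pr q)"
proof -
  have "0 = H u - f + adjoint G q" "q \<in> face p" "0 = p - G u"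
    using assms by (auto simp: kkt_def zero_prod_def)
  then have "H u = f - adjoint G q" "p = G u" by (simp_all add: algebra_simps)
  then have "u = pr q" "p = G u" by (auto intro: pr_eqI)
  moreover from this have "dual_sub 0 q" using \<open>q \<in> face p\<close> by (intro dual_subI) (auto simp: face_def)
  ultimately show "dual_sub 0 q" "u = pr q" "p = G (pr q)" by auto
qed

lemma face_iff_dual: "q \<in> face (v + G (pr q)) \<longleftrightarrow> dual_sub v q"
  using dual_sub_support[of v q] dual_subI[of q v] by (auto simp: face_def dual_sub_def)

section \<open>Contraction of the proximal step\<close>

lemma closed_solutions: "closed {q. dual_sub 0 q}"
  unfolding closed_sequential_limits using dual_sub_closed[of "\<lambda>k. 0"] by auto

lemma prox_step_le_infdist:
  assumes "0 < s"
  shows "norm (x - prox s x) \<le> infdist x {q. dual_sub 0 q}"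
proof -
  obtain q where q: "dual_sub 0 q" "infdist x {q. dual_sub 0 q} = dist x q"
    using infdist_attains_inf[OF closed_solutions] dual_sub_zero_exists by blast
  have "(norm (x - prox s x))\<^sup>2 \<le> (norm (x - q))\<^sup>2"
    using prox_firm[OF assms q(1), of x] by (smt (verit) zero_le_power2)
  then show ?thesis using q(2) by (simp add: dist_norm power2_le_iff_abs_le)
qed

text \<open>Firm nonexpansiveness gives \<open>r^2 + n^2 \<le> d^2\<close> and the subregularity
  bound gives \<open>r * s \<le> \<kappa> * n\<close>; eliminating the step length \<open>n\<close>
  leaves the rate.\<close>

lemma prox_contraction:
  assumes s: "0 < s" and k: "0 \<le> \<kappa>"
    and le: "infdist (prox s x) {q. dual_sub 0 q} \<le> \<kappa> * (norm (x - prox s x) / s)"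
  shows "infdist (prox s x) {q. dual_sub 0 q} \<le> rate_d \<kappa> s * infdist x {q. dual_sub 0 q}"
proof -
  define r d n where "r = infdist (prox s x) {q. dual_sub 0 q}" and "d = infdist x {q. dual_sub 0 q}"
    and "n = norm (x - prox s x)"
  obtain q where q: "dual_sub 0 q" "d = dist x q"
    using infdist_attains_inf[OF closed_solutions] dual_sub_zero_exists unfolding d_def by blast
  have r0: "0 \<le> r" "0 \<le> d" by (simp_all add: r_def d_def infdist_nonneg)
  have "r \<le> norm (prox s x - q)"
    unfolding r_def using q(1) infdist_le[of q "{q. dual_sub 0 q}" "prox s x"] by (simp add: dist_norm)
  then have "r\<^sup>2 \<le> (norm (prox s x - q))\<^sup>2" using r0 by (intro power_mono)
  then have "r\<^sup>2 + n\<^sup>2 \<le> d\<^sup>2"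
    using prox_firm[OF s q(1), of x] q(2) by (simp add: n_def dist_norm)
  moreover have "r * s \<le> \<kappa> * n"
    using le s by (simp add: r_def n_def pos_le_divide_eq)
  then have "(r * s)\<^sup>2 \<le> (\<kappa> * n)\<^sup>2" using r0 s by (intro power_mono) auto
  ultimately have "r\<^sup>2 * (\<kappa>\<^sup>2 + s\<^sup>2) \<le> \<kappa>\<^sup>2 * d\<^sup>2"
    using mult_left_mono[of "r\<^sup>2 + n\<^sup>2" "d\<^sup>2" "\<kappa>\<^sup>2"] by (simp add: power_mult_distrib algebra_simps)
  also have "r\<^sup>2 * (\<kappa>\<^sup>2 + s\<^sup>2) = (r * sqrt (\<kappa>\<^sup>2 + s\<^sup>2))\<^sup>2" by (simp add: power_mult_distrib)
  finally have "(r * sqrt (\<kappa>\<^sup>2 + s\<^sup>2))\<^sup>2 \<le> (\<kappa> * d)\<^sup>2" by (simp only: power_mult_distrib)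
  then have "r * sqrt (\<kappa>\<^sup>2 + s\<^sup>2) \<le> \<kappa> * d"
    by (rule power2_le_imp_le) (use k r0 in simp)
  moreover have "0 < sqrt (\<kappa>\<^sup>2 + s\<^sup>2)" using s by (simp add: add_nonneg_pos)
  ultimately have "r \<le> rate_d \<kappa> s * d" by (simp add: rate_d_def pos_le_divide_eq)
  then show ?thesis by (simp add: r_def d_def)
qed

section \<open>Box constraints and strict complementarity\<close>

lemma box_active:
  assumes C: "C = {q. \<forall>b\<in>Basis. \<bar>q \<bullet> b\<bar> \<le> \<alpha>}" and \<alpha>: "0 < \<alpha>"
    and q: "dual_sub v q" "b \<in> Basis" and nz: "(v + G (pr q)) \<bullet> b \<noteq> 0"
  shows "q \<bullet> b = sgn ((v + G (pr q)) \<bullet> b) * \<alpha>"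
proof -
  have Cb: "y \<in> C \<longleftrightarrow> (\<forall>b\<in>Basis. \<bar>y \<bullet> b\<bar> \<le> \<alpha>)" for y by (simp add: C)
  have bound: "\<bar>q \<bullet> b\<bar> \<le> \<alpha>" using q by (auto simp: Cb dual_sub_def)
  \<comment> \<open>Changing only coordinate \<open>b\<close> to any admissible \<open>t\<close>
    stays in the box, so the variational inequality decouples.\<close>
  have "(v + G (pr q)) \<bullet> b * (t - q \<bullet> b) \<le> 0" if "\<bar>t\<bar> \<le> \<alpha>" for t
  proof -
    have "q + (t - q \<bullet> b) *\<^sub>R b \<in> C"
      using that q by (auto simp: Cb dual_sub_def inner_add_left inner_Basis)
    then have "(v + G (pr q)) \<bullet> ((q + (t - q \<bullet> b) *\<^sub>R b) - q) \<le> 0"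
      using q(1) unfolding dual_sub_def by blast
    then show ?thesis by (simp add: mult.commute)
  qed
  from this[of "sgn ((v + G (pr q)) \<bullet> b) * \<alpha>"] show ?thesis
    using bound nz \<alpha> by (cases "(v + G (pr q)) \<bullet> b > 0") (auto simp: mult_le_0_iff)
qed

lemma box_inactive:
  assumes C: "C = {q. \<forall>b\<in>Basis. \<bar>q \<bullet> b\<bar> \<le> \<alpha>}" and \<alpha>: "0 < \<alpha>"
    and q: "dual_sub v q" "b \<in> Basis" and less: "\<bar>q \<bullet> b\<bar> < \<alpha>"
  shows "(v + G (pr q)) \<bullet> b = 0"
proof (rule ccontr)
  assume "(v + G (pr q)) \<bullet> b \<noteq> 0"
  then have "\<bar>q \<bullet> b\<bar> = \<alpha>" using box_active[OF C \<alpha> q] \<alpha> by (simp add: abs_mult abs_sgn_eq)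
  then show False using less by simp
qed

text \<open>Strict complementarity freezes the active coordinates, so near \<open>q\<close> the inclusion is the linear
  system \<open>L e = v\<close> on the inactive ones; a right inverse of \<open>L\<close> on its range gives the modulus.\<close>

lemma strict_complementarity_subreg:
  assumes C: "C = {q. \<forall>b\<in>Basis. \<bar>q \<bullet> b\<bar> \<le> \<alpha>}" and \<alpha>: "0 < \<alpha>"
    and q: "dual_sub 0 q"
    and sc: "\<And>b. b \<in> Basis \<Longrightarrow> \<bar>q \<bullet> b\<bar> < \<alpha> \<or> G (pr q) \<bullet> b \<noteq> 0"
  shows "\<exists>\<kappa>. metric_subreg (\<lambda>q. {v. dual_sub v q}) q 0 \<kappa>"
proof -
  have Cb: "y \<in> C \<longleftrightarrow> (\<forall>b\<in>Basis. \<bar>y \<bullet> b\<bar> \<le> \<alpha>)" for y by (simp add: C)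
  \<comment> \<open>The coordinates with vanishing gradient; \<open>sc\<close> puts \<open>q\<close>
    strictly between the bounds there.\<close>
  define I where "I = {b \<in> Basis. G (pr q) \<bullet> b = 0}"
  have I: "I \<subseteq> Basis" "finite I" by (auto simp: I_def intro: finite_subset[OF _ finite_Basis])
  define P where "P e = (\<Sum>b\<in>I. (e \<bullet> b) *\<^sub>R b)" for e
  have P_inner: "P e \<bullet> b = (if b \<in> I then e \<bullet> b else 0)" if "b \<in> Basis" for e b
  proof -
    have "P e \<bullet> b = (\<Sum>b'\<in>I. if b' = b then e \<bullet> b else 0)"
      unfolding P_def inner_sum_left using I(1) that by (intro sum.cong) (auto simp: inner_Basis)
    then show ?thesis using I(2) by simp
  qed
  have P_sym: "P e \<bullet> e' = e \<bullet> P e'" for e e'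
    unfolding P_def inner_sum_left inner_sum_right
    by (intro sum.cong) (simp_all add: inner_commute)
  have linP: "linear P"
    by (intro linearI) (simp_all add: euclidean_eq_iff[where 'a='y] P_inner inner_add_left)
  have PP: "P (P e) = P e" for e by (simp add: euclidean_eq_iff[where 'a='y] P_inner)
  have P_le: "norm (P e) \<le> norm e" for e
  proof -
    have "(norm (P e))\<^sup>2 = e \<bullet> P e" using P_sym[of e "P e"] PP by (simp add: power2_norm_eq_inner)
    also have "\<dots> \<le> norm e * norm (P e)" by (rule norm_cauchy_schwarz)
    finally show ?thesis
      by (cases "norm (P e) = 0") (simp_all add: power2_eq_square mult_le_cancel_right)
  qed
  \<comment> \<open>The Hessian of \<open>Q\<close>; its quadratic form is the energy of the induced
    primal displacement.\<close>
  define A where "A e = G (inv H (adjoint G e))" for e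
  have linA: "linear A"
    using linear_compose[OF linear_compose[OF linear_adj linear_inv] linear_G]
    by (simp add: A_def[abs_def] o_def)
  have G_pr: "G (pr y) = G (pr q) - A (y - q)" for y
  proof -
    have "pr y = pr q - inv H (adjoint G (y - q))" using pr_diff[of y q] by (simp add: algebra_simps)
    then show ?thesis by (simp add: A_def linear_diff[OF linear_G])
  qed
  have A_zero: "pr (q + e) = pr q" if "e \<bullet> A e = 0" for e
  proof -
    have "inv H (adjoint G e) \<bullet> adjoint G e = 0"
      using that by (simp add: A_def adj inner_commute)
    then have "inv H (adjoint G e) = 0"
      using pos_H[of "inv H (adjoint G e)"] by (auto simp: H_inv inner_commute)
    then show ?thesis using pr_diff[of "q + e" q] by simp
  qed
  define L where "L e = P (A (P e))" for e
  have linL: "linear L"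
    using linear_compose[OF linear_compose[OF linP linA] linP] by (simp add: L_def[abs_def] o_def)
  obtain g where g: "linear g" "\<And>v. v \<in> range L \<Longrightarrow> L (g v) = v"
    using linear_exists_right_inverse_on[OF linL, of UNIV] by auto
  obtain B where B: "0 < B" "\<And>v. norm (g v) \<le> norm v * B"
    using bounded_linear.pos_bounded g(1) by (metis linear_conv_bounded_linear)
  define J where "J = Basis - I"
  have J: "b \<in> J \<longleftrightarrow> b \<in> Basis \<and> G (pr q) \<bullet> b \<noteq> 0" for b by (auto simp: J_def I_def)
  \<comment> \<open>Least slack over \<open>I\<close>; the inserted 1 covers an empty
    \<open>I\<close>, and likewise an empty \<open>J\<close> for \<open>c\<close> below.\<close>
  define m where "m = Min (insert 1 ((\<lambda>b. \<alpha> - \<bar>q \<bullet> b\<bar>) ` I))"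
  have m0: "0 < m" unfolding m_def using sc I by (auto simp: I_def)
  have m: "m \<le> \<alpha> - \<bar>q \<bullet> b\<bar>" if "b \<in> I" for b
    unfolding m_def using that I(2) by (intro Min_le) auto
  define c where "c = Min (insert 1 ((\<lambda>b. \<bar>G (pr q) \<bullet> b\<bar>) ` J))"
  have finJ: "finite J" by (simp add: J_def)
  have c0: "0 < c" unfolding c_def using finJ by (auto simp: J)
  have c: "c \<le> \<bar>G (pr q) \<bullet> b\<bar>" if "b \<in> J" for b
    unfolding c_def using that finJ by (intro Min_le) auto
  obtain b0 where b0: "0 < b0" "\<And>e. norm (A e) \<le> norm e * b0"
    using bounded_linear.pos_bounded linA by (metis linear_conv_bounded_linear)
  \<comment> \<open>\<open>m / 2\<close> keeps \<open>x\<close> off the bounds on \<open>I\<close>,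
    the two terms with \<open>c\<close> preserve the gradient signs on \<open>J\<close>, and
    \<open>m / (2 * B)\<close> keeps the corrected point \<open>y\<close> feasible.\<close>
  define r where "r = min (m / 2) (min (c / (2 * b0)) (min (c / 2) (m / (2 * B))))"
  have r0: "0 < r" using m0 c0 b0 B by (simp add: r_def)
  have r: "r \<le> m / 2" "r * b0 \<le> c / 2" "r \<le> c / 2" "r * B \<le> m / 2"
  proof -
    have "r \<le> c / (2 * b0)" "r \<le> m / (2 * B)" by (auto simp: r_def)
    then show "r * b0 \<le> c / 2" "r * B \<le> m / 2"
      using b0 B by (auto simp: pos_le_divide_eq)
  qed (auto simp: r_def)
  note active = box_active[OF C \<alpha>] and inactive = box_inactive[OF C \<alpha>]
  have bound: "\<bar>y \<bullet> b\<bar> \<le> \<alpha>" if "dual_sub v y" "b \<in> Basis" for v y b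
    using that by (auto simp: Cb dual_sub_def)
  have main: "\<exists>y. dual_sub 0 y \<and> dist x y \<le> B * norm v"
    if v: "dual_sub v x" and x: "norm (x - q) < r" and vr: "norm v < r" for x v
  proof -
    define e where "e = x - q"
    \<comment> \<open>The normal vectors at \<open>x\<close> and at \<open>q\<close> have the same
      nonzero sign in this coordinate, so both points sit at the same endpoint.\<close>
    have "e \<bullet> b = 0" if b: "b \<in> J" for b
    proof -
      have bB: "b \<in> Basis" using b J by auto
      have "\<bar>A e \<bullet> b\<bar> \<le> norm e * b0" using b0(2)[of e] Basis_le_norm[OF bB, of "A e"] by linarith
      also have "\<dots> < r * b0" using x b0 by (simp add: e_def)
      finally have "\<bar>A e \<bullet> b\<bar> < c / 2" using r by linarith
      moreover have "\<bar>v \<bullet> b\<bar> < c / 2" using Basis_le_norm[OF bB, of v] vr r by linarith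
      moreover have eq: "(v + G (pr x)) \<bullet> b = G (pr q) \<bullet> b + v \<bullet> b - A e \<bullet> b"
        unfolding G_pr[of x] by (simp add: e_def inner_simps)
      ultimately have "sgn ((v + G (pr x)) \<bullet> b) = sgn (G (pr q) \<bullet> b)" "(v + G (pr x)) \<bullet> b \<noteq> 0"
        using c[OF b] by (auto simp: sgn_if)
      then show ?thesis
        using active[OF v bB] active[OF q bB] b J by (simp add: e_def inner_diff_left)
    qed
    then have Pe: "P e = e"
      by (auto simp: euclidean_eq_iff[where 'a='y] P_inner J_def)
    have "A e \<bullet> b = v \<bullet> b" if b: "b \<in> I" for b
    proof -
      have bB: "b \<in> Basis" using b I by auto
      have "\<bar>x \<bullet> b\<bar> \<le> \<bar>q \<bullet> b\<bar> + norm e"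
        using Basis_le_norm[OF bB, of e] by (simp add: e_def inner_diff_left)
      then have "\<bar>x \<bullet> b\<bar> < \<alpha>" using m[OF b] x r m0 by (simp add: e_def)
      then have "(v + G (pr x)) \<bullet> b = 0" by (rule inactive[OF v bB])
      then show ?thesis using b unfolding G_pr[of x] by (simp add: e_def inner_simps I_def)
    qed
    then have Le: "L e = P v"
      by (auto simp: L_def Pe euclidean_eq_iff[where 'a='y] P_inner)
    \<comment> \<open>\<open>e'\<close> solves the same linear system as \<open>e\<close>, with norm
      controlled by \<open>v\<close>. The difference lies in the kernel of \<open>L\<close> and
      leads to the dual solution \<open>y\<close>.\<close>
    define e' where "e' = g (L e)"
    have Le': "L e' = L e" unfolding e'_def by (rule g) simp
    have "norm e' \<le> norm v * B"
      using B(2)[of "P v"] P_le[of v] B(1) unfolding e'_def Le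
      by (meson mult_right_mono less_imp_le order_trans)
    define y where "y = q + P (e - e')"
    have xy: "x - y = P e'"
      using Pe by (simp add: y_def linear_diff[OF linP] e_def)
    then have dist: "dist x y \<le> B * norm v"
      using P_le[of e'] \<open>norm e' \<le> norm v * B\<close> by (simp add: dist_norm mult.commute)
    have "P (e - e') \<bullet> A (P (e - e')) = (e - e') \<bullet> L (e - e')"
      by (simp add: L_def P_sym)
    also have "\<dots> = 0" by (simp add: linear_diff[OF linL] Le')
    finally have pry: "pr y = pr q" unfolding y_def by (rule A_zero)
    have yb: "y \<bullet> b = q \<bullet> b" if "b \<in> Basis" "b \<notin> I" for b
      using that by (simp add: y_def inner_add_left P_inner)
    have "\<bar>y \<bullet> b\<bar> \<le> \<alpha>" if b: "b \<in> Basis" for b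
    proof (cases "b \<in> I")
      case True
      have "norm (y - q) \<le> norm (x - q) + norm (x - y)"
        by (metis dist_commute dist_norm dist_triangle2 add.commute dist_triangle)
      also have "\<dots> \<le> m / 2 + m / 2"
      proof (intro add_mono)
        show "norm (x - q) \<le> m / 2" using x r by simp
        have "norm (x - y) \<le> B * norm v" using dist by (simp add: dist_norm)
        also have "\<dots> \<le> B * r" using vr B by (intro mult_left_mono) auto
        finally show "norm (x - y) \<le> m / 2" using r by (simp add: mult.commute)
      qed
      finally have "\<bar>(y - q) \<bullet> b\<bar> \<le> m" using Basis_le_norm[OF b, of "y - q"] by simp
      then show ?thesis using m[OF True] by (simp add: inner_diff_left)
    next
      case False
      then show ?thesis using yb[OF b] bound[OF q b] by simp
    qed
    then have yC: "y \<in> C" by (simp add: Cb)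
    \<comment> \<open>\<open>y - q\<close> is supported on \<open>I\<close>, where the gradient
      vanishes, so \<open>y\<close> inherits the variational inequality of \<open>q\<close>.\<close>
    have "G (pr q) \<bullet> (y - q) = 0"
      using yb by (subst euclidean_inner, intro sum.neutral) (auto simp: I_def inner_diff_left)
    then have "(0 + G (pr y)) \<bullet> (q' - y) \<le> 0" if "q' \<in> C" for q'
      using q that unfolding dual_sub_def pry by (auto simp: inner_diff_right)
    then have "dual_sub 0 y" using yC by (simp add: dual_sub_def)
    then show ?thesis using dist by blast
  qed
  have "infdist x {x'. 0 \<in> {v. dual_sub v x'}} \<le> B * infdist 0 ({v. dual_sub v x} \<inter> ball 0 r)"
    if x: "x \<in> ball q r" and ne: "{v. dual_sub v x} \<inter> ball 0 r \<noteq> {}" for x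
  proof -
    have "infdist x {q. dual_sub 0 q} / B \<le> dist 0 v" if v: "v \<in> {v. dual_sub v x} \<inter> ball 0 r" for v
    proof -
      obtain y where "dual_sub 0 y" "dist x y \<le> B * norm v"
        using main[of v x] v x by (auto simp: dist_norm norm_minus_commute)
      then have "infdist x {q. dual_sub 0 q} \<le> B * norm v" by (intro infdist_le2) auto
      then show ?thesis using B by (simp add: pos_divide_le_eq mult.commute)
    qed
    then have "infdist x {q. dual_sub 0 q} / B \<le> infdist 0 ({v. dual_sub v x} \<inter> ball 0 r)"
      unfolding infdist_notempty[OF ne] by (intro cINF_greatest ne)
    then show ?thesis using B by (simp add: pos_divide_le_eq mult.commute)
  qed
  moreover have "open (ball q r)" "q \<in> ball q r" "open (ball (0::'y) r)" "0 \<in> ball (0::'y) r"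
    using r0 by auto
  ultimately have "metric_subreg (\<lambda>q. {v. dual_sub v q}) q 0 B"
    unfolding metric_subreg_def using B q by (intro conjI exI[of _ "ball q r"] exI[of _ "ball 0 r"]) auto
  then show ?thesis by blast
qed

end

subsection \<open>The inexact method\<close>

locale inexact_alm = dual_qp H G f C h
  for H :: "'x::euclidean_space \<Rightarrow> 'x" and G :: "'x \<Rightarrow> 'y::euclidean_space" and f C h +
  fixes a :: real and \<sigma> :: "nat \<Rightarrow> real" and sigma_inf :: real
    and u :: "nat \<Rightarrow> 'x" and p l :: "nat \<Rightarrow> 'y" and \<epsilon> :: "nat \<Rightarrow> real"
  assumes \<sigma>_pos: "0 < \<sigma> k" and incseq_\<sigma>: "incseq \<sigma>" and \<sigma>_lim: "\<sigma> \<longlonglongrightarrow> sigma_inf"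
    and l_Suc: "l (Suc k) = l k + \<sigma> k *\<^sub>R (G (u (Suc k)) - p (Suc k))"
    and \<epsilon>_nonneg: "0 \<le> \<epsilon> k" and summable_\<epsilon>: "summable \<epsilon>"
    and gap: "Phi a (\<sigma> k) (l k) (u (Suc k), p (Suc k)) - (INF w. Phi a (\<sigma> k) (l k) w)
      \<le> (\<epsilon> k)\<^sup>2 / (2 * \<sigma> k)"
begin

section \<open>Error of one step and convergence of the iterates\<close>

definition exact where "exact k = prox (\<sigma> k) (l k)"

lemma sigma_inf_pos: "0 < sigma_inf"
  using incseq_le[OF incseq_\<sigma> \<sigma>_lim, of 0] \<sigma>_pos[of 0] by linarith

text \<open>Only the multiplier part of \<open>Phi_gap\<close> is kept. The bound \<open>e\<close>
  is free, so that (A) applies with \<open>\<epsilon> k\<close> and (B1) with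
  \<open>\<delta> k\<close> times the multiplier step.\<close>

lemma multiplier_error:
  assumes "0 \<le> e" and "Phi a (\<sigma> k) (l k) (u (Suc k), p (Suc k)) - (INF w. Phi a (\<sigma> k) (l k) w)
      \<le> e\<^sup>2 / (2 * \<sigma> k)"
  shows "norm (l (Suc k) - exact k) \<le> e"
proof -
  have "(norm (l (Suc k) - exact k))\<^sup>2 / (2 * \<sigma> k) \<le> e\<^sup>2 / (2 * \<sigma> k)"
    using Phi_gap[OF \<sigma>_pos assms(2)] energy_nonneg[of "u (Suc k) - pr (exact k)"]
    unfolding l_Suc[symmetric] exact_def by simp
  then have "(norm (l (Suc k) - exact k))\<^sup>2 \<le> e\<^sup>2"
    using \<sigma>_pos[of k] by (simp add: divide_le_cancel)
  then show ?thesis using assms(1) by (simp add: power2_le_iff_abs_le)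
qed

lemma primal_error: "H (u (Suc k) - pr (exact k)) \<bullet> (u (Suc k) - pr (exact k)) \<le> (\<epsilon> k)\<^sup>2 / \<sigma> k"
proof -
  have "0 \<le> (norm (l (Suc k) - exact k))\<^sup>2 / (2 * \<sigma> k)" using \<sigma>_pos[of k] by simp
  then show ?thesis
    using Phi_gap[OF \<sigma>_pos gap[of k]] unfolding l_Suc[symmetric] exact_def by simp
qed

text \<open>The exact step does not increase the distance to \<open>q\<close>, and inexactness adds
  at most \<open>\<epsilon> k\<close>.\<close>

lemma convergent_dist_solution:
  assumes "dual_sub 0 q"
  shows "convergent (\<lambda>k. norm (l k - q))"
proof (rule convergent_quasi_decreasing[OF _ \<epsilon>_nonneg summable_\<epsilon>])
  fix k
  have "(norm (exact k - q))\<^sup>2 \<le> (norm (l k - q))\<^sup>2"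
    using prox_firm[OF \<sigma>_pos assms, of k "l k"] unfolding exact_def by (smt (verit) zero_le_power2)
  then have "norm (exact k - q) \<le> norm (l k - q)" by (simp add: power2_le_iff_abs_le)
  moreover have "norm (l (Suc k) - q) \<le> norm (l (Suc k) - exact k) + norm (exact k - q)"
    using norm_triangle_ineq[of "l (Suc k) - exact k" "exact k - q"] by simp
  ultimately show "norm (l (Suc k) - q) \<le> norm (l k - q) + \<epsilon> k"
    using multiplier_error[OF \<epsilon>_nonneg gap, of k] by linarith
qed simp

text \<open>In the firm inequality the distances before and after the step have the same limit,
  which squeezes the step length to zero.\<close>

lemma prox_step_tendsto: "(\<lambda>k. l k - exact k) \<longlonglongrightarrow> 0"
proof -
  obtain q where q: "dual_sub 0 q" using dual_sub_zero_exists by blast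
  obtain c where c: "(\<lambda>k. norm (l k - q)) \<longlonglongrightarrow> c"
    using convergent_dist_solution[OF q] by (auto simp: convergent_def)
  have \<epsilon>: "\<epsilon> \<longlonglongrightarrow> 0" by (rule summable_LIMSEQ_zero[OF summable_\<epsilon>])
  \<comment> \<open>Truncation at 0 keeps the lower bound for \<open>norm (exact k - q)\<close>
    nonnegative, hence safe to square.\<close>
  have bound: "(norm (l k - exact k))\<^sup>2 \<le> (norm (l k - q))\<^sup>2 - (max 0 (norm (l (Suc k) - q) - \<epsilon> k))\<^sup>2" for k
  proof -
    have "norm (l (Suc k) - q) \<le> norm (l (Suc k) - exact k) + norm (exact k - q)"
      using norm_triangle_ineq[of "l (Suc k) - exact k" "exact k - q"] by simp
    then have "max 0 (norm (l (Suc k) - q) - \<epsilon> k) \<le> norm (exact k - q)"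
      using multiplier_error[OF \<epsilon>_nonneg gap, of k] by simp
    then have "(max 0 (norm (l (Suc k) - q) - \<epsilon> k))\<^sup>2 \<le> (norm (exact k - q))\<^sup>2" by (intro power_mono) auto
    then show ?thesis using prox_firm[OF \<sigma>_pos q, of k "l k"] unfolding exact_def by linarith
  qed
  have c0: "0 \<le> c" by (rule LIMSEQ_le_const[OF c]) auto
  have "(\<lambda>k. (norm (l k - q))\<^sup>2 - (max 0 (norm (l (Suc k) - q) - \<epsilon> k))\<^sup>2) \<longlonglongrightarrow> c\<^sup>2 - (max 0 (c - 0))\<^sup>2"
    by (intro tendsto_intros c \<epsilon> LIMSEQ_Suc)
  then have "(\<lambda>k. (norm (l k - q))\<^sup>2 - (max 0 (norm (l (Suc k) - q) - \<epsilon> k))\<^sup>2) \<longlonglongrightarrow> 0" using c0 by simp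
  then have "(\<lambda>k. (norm (l k - exact k))\<^sup>2) \<longlonglongrightarrow> 0"
    using bound by (intro tendsto_sandwich[of "\<lambda>_. 0" "\<lambda>k. (norm (l k - exact k))\<^sup>2"]) auto
  then have "(\<lambda>k. sqrt ((norm (l k - exact k))\<^sup>2)) \<longlonglongrightarrow> sqrt 0" by (rule tendsto_real_sqrt)
  then show ?thesis by (simp add: tendsto_norm_zero_iff)
qed

lemma scaled_prox_step_tendsto: "(\<lambda>k. (1 / \<sigma> k) *\<^sub>R (l k - exact k)) \<longlonglongrightarrow> 0"
proof -
  have "(\<lambda>k. (1 / \<sigma> k) *\<^sub>R (l k - exact k)) \<longlonglongrightarrow> (1 / sigma_inf) *\<^sub>R 0"
    using sigma_inf_pos by (intro tendsto_intros \<sigma>_lim prox_step_tendsto) auto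
  then show ?thesis by simp
qed

lemma dual_sub_exact: "dual_sub ((1 / \<sigma> k) *\<^sub>R (l k - exact k)) (exact k)"
  unfolding exact_def by (rule prox_works[OF \<sigma>_pos])

text \<open>Opial's argument: by the closed graph a cluster point is a dual solution; the distance
  to it converges, and along the subsequence it tends to zero.\<close>

lemma l_converges: "\<exists>ls. dual_sub 0 ls \<and> l \<longlonglongrightarrow> ls"
proof -
  obtain q where q: "dual_sub 0 q" using dual_sub_zero_exists by blast
  have "Bseq (\<lambda>k. norm (l k - q))"
    using convergent_dist_solution[OF q] by (rule convergent_imp_Bseq)
  then obtain K where K: "\<And>k. norm (l k - q) \<le> K" by (auto simp: Bseq_def)
  have "norm (l k) \<le> K + norm q" for k using K[of k] norm_triangle_ineq[of "l k - q" q] by simp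
  then have "bounded (range l)" by (auto simp: bounded_iff)
  then obtain ls r where r: "strict_mono r" "(l \<circ> r) \<longlonglongrightarrow> ls"
    using bounded_imp_convergent_subsequence by blast
  have "(\<lambda>k. l (r k) - (l (r k) - exact (r k))) \<longlonglongrightarrow> ls - 0"
    using r LIMSEQ_subseq_LIMSEQ[OF prox_step_tendsto r(1)] by (intro tendsto_diff) (auto simp: o_def)
  then have "(\<lambda>k. exact (r k)) \<longlonglongrightarrow> ls" by simp
  moreover have "(\<lambda>k. (1 / \<sigma> (r k)) *\<^sub>R (l (r k) - exact (r k))) \<longlonglongrightarrow> 0"
    using LIMSEQ_subseq_LIMSEQ[OF scaled_prox_step_tendsto r(1)] by (simp add: o_def)
  ultimately have ls: "dual_sub 0 ls"
    using dual_sub_closed[of "\<lambda>k. (1 / \<sigma> (r k)) *\<^sub>R (l (r k) - exact (r k))" "\<lambda>k. exact (r k)"] dual_sub_exact by blast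
  obtain c where c: "(\<lambda>k. norm (l k - ls)) \<longlonglongrightarrow> c"
    using convergent_dist_solution[OF ls] by (auto simp: convergent_def)
  have "(\<lambda>k. norm (l (r k) - ls)) \<longlonglongrightarrow> c" using LIMSEQ_subseq_LIMSEQ[OF c r(1)] by (simp add: o_def)
  moreover have "(\<lambda>k. norm (l (r k) - ls)) \<longlonglongrightarrow> norm (ls - ls)"
    using r(2) by (intro tendsto_intros) (simp add: o_def)
  ultimately have "c = 0" using LIMSEQ_unique by fastforce
  then have "(\<lambda>k. l k - ls) \<longlonglongrightarrow> 0" using c by (simp add: tendsto_norm_zero_iff)
  then show ?thesis using ls LIM_zero_iff by blast
qed

lemma exact_tendsto: "l \<longlonglongrightarrow> ls \<Longrightarrow> exact \<longlonglongrightarrow> ls"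
  using tendsto_diff[OF _ prox_step_tendsto, of l ls] by simp

text \<open>Coercivity turns the energy bound on \<open>u (Suc k) - pr (exact k)\<close> into norm
  convergence, and \<open>pr\<close> is continuous.\<close>

lemma u_tendsto:
  assumes "l \<longlonglongrightarrow> ls"
  shows "u \<longlonglongrightarrow> pr ls"
proof -
  obtain m where m: "0 < m" "\<And>v. m * (norm v)\<^sup>2 \<le> H v \<bullet> v" using coercive by blast
  have "(\<lambda>k. (\<epsilon> k)\<^sup>2 / \<sigma> k / m) \<longlonglongrightarrow> 0\<^sup>2 / sigma_inf / m"
    using sigma_inf_pos m by (intro tendsto_intros \<sigma>_lim summable_LIMSEQ_zero[OF summable_\<epsilon>]) auto
  then have "(\<lambda>k. (\<epsilon> k)\<^sup>2 / \<sigma> k / m) \<longlonglongrightarrow> 0" by simp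
  moreover have "(norm (u (Suc k) - pr (exact k)))\<^sup>2 \<le> (\<epsilon> k)\<^sup>2 / \<sigma> k / m" for k
    using order_trans[OF m(2) primal_error[of k]] m(1) by (subst pos_le_divide_eq) (simp_all add: mult.commute)
  ultimately have "(\<lambda>k. (norm (u (Suc k) - pr (exact k)))\<^sup>2) \<longlonglongrightarrow> 0"
    by (intro tendsto_sandwich[of "\<lambda>_. 0" "\<lambda>k. (norm (u (Suc k) - pr (exact k)))\<^sup>2"]) auto
  then have "(\<lambda>k. sqrt ((norm (u (Suc k) - pr (exact k)))\<^sup>2)) \<longlonglongrightarrow> sqrt 0" by (rule tendsto_real_sqrt)
  then have "(\<lambda>k. u (Suc k) - pr (exact k)) \<longlonglongrightarrow> 0" by (simp add: tendsto_norm_zero_iff)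
  from tendsto_add[OF this tendsto_pr[OF exact_tendsto[OF assms]]]
  have "(\<lambda>k. u (Suc k)) \<longlonglongrightarrow> pr ls" by simp
  then show ?thesis by (rule LIMSEQ_imp_Suc)
qed

lemma residual: "p (Suc k) - G (u (Suc k)) = - ((1 / \<sigma> k) *\<^sub>R (l (Suc k) - l k))"
  using \<sigma>_pos[of k] by (simp add: l_Suc)

lemma residual_tendsto:
  assumes "l \<longlonglongrightarrow> ls"
  shows "(\<lambda>k. norm (l (Suc k) - l k) / \<sigma> k) \<longlonglongrightarrow> 0"
proof -
  have "(\<lambda>k. norm (l (Suc k) - l k) / \<sigma> k) \<longlonglongrightarrow> norm (ls - ls) / sigma_inf"
    using sigma_inf_pos by (intro tendsto_intros \<sigma>_lim assms LIMSEQ_Suc[OF assms]) auto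
  then show ?thesis by simp
qed

lemma p_tendsto:
  assumes "l \<longlonglongrightarrow> ls"
  shows "p \<longlonglongrightarrow> G (pr ls)"
proof -
  have "(\<lambda>k. G (u (Suc k)) - (1 / \<sigma> k) *\<^sub>R (l (Suc k) - l k)) \<longlonglongrightarrow> G (pr ls) - (1 / sigma_inf) *\<^sub>R (ls - ls)"
    using sigma_inf_pos
    by (intro tendsto_intros \<sigma>_lim tendsto_G LIMSEQ_Suc[OF u_tendsto] LIMSEQ_Suc[OF assms] assms) auto
  moreover have "p (Suc k) = G (u (Suc k)) - (1 / \<sigma> k) *\<^sub>R (l (Suc k) - l k)" for k
    using residual[of k] by (simp add: algebra_simps)
  ultimately have "(\<lambda>k. p (Suc k)) \<longlonglongrightarrow> G (pr ls)" by simp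
  then show ?thesis by (rule LIMSEQ_imp_Suc)
qed

section \<open>Local convergence rates\<close>

lemma rate_d_tendsto: "(\<lambda>k. rate_d \<kappa> (\<sigma> k)) \<longlonglongrightarrow> rate_d \<kappa> sigma_inf"
  unfolding rate_d_def using sigma_inf_pos
  by (intro tendsto_intros \<sigma>_lim) (auto simp: sum_power2_eq_zero_iff)

lemma rate_d_less: "rate_d \<kappa> sigma_inf < 1"
proof -
  have "\<kappa> \<le> sqrt (\<kappa>\<^sup>2)" by simp
  also have "\<dots> < sqrt (\<kappa>\<^sup>2 + sigma_inf\<^sup>2)" using sigma_inf_pos by (intro real_sqrt_less_mono) simp
  finally show ?thesis unfolding rate_d_def
    by (subst divide_less_eq_1_pos) (use sigma_inf_pos in \<open>auto intro: add_nonneg_pos\<close>)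
qed

text \<open>Splitting off the exact proximal point on both sides gives
  \<open>\<parallel>l (Suc k) - l k\<parallel> \<le> dist (l k, S) / (1 - \<delta> k)\<close>, whence the factor \<open>1 / (1 - \<delta> k)\<close>.\<close>

lemma linear_rate:
  assumes sub: "metric_subreg (\<lambda>q. {v. dual_sub v q}) ls 0 \<kappa>" and ls: "l \<longlonglongrightarrow> ls"
    and \<delta>: "\<And>k. 0 \<le> \<delta> k" "summable \<delta>"
    and gap': "\<And>k. Phi a (\<sigma> k) (l k) (u (Suc k), p (Suc k)) - (INF w. Phi a (\<sigma> k) (l k) w)
      \<le> (\<delta> k)\<^sup>2 / (2 * \<sigma> k) * (norm (l (Suc k) - l k))\<^sup>2"
  defines "S \<equiv> {q. dual_sub 0 q}"
  shows "\<forall>\<^sub>F k in sequentially.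
    infdist (l (Suc k)) S \<le> (rate_d \<kappa> (\<sigma> k) + \<delta> k) / (1 - \<delta> k) * infdist (l k) S"
proof -
  obtain U V where UV: "open U" "ls \<in> U" "open V" "0 \<in> V" and \<kappa>: "0 \<le> \<kappa>"
    and sub': "\<And>y. y \<in> U \<Longrightarrow> {v. dual_sub v y} \<inter> V \<noteq> {} \<Longrightarrow>
      infdist y S \<le> \<kappa> * infdist 0 ({v. dual_sub v y} \<inter> V)"
    using sub unfolding metric_subreg_def S_def by auto
  have "\<forall>\<^sub>F k in sequentially. exact k \<in> U"
    by (rule topological_tendstoD[OF exact_tendsto[OF ls] UV(1,2)])
  moreover have "\<forall>\<^sub>F k in sequentially. (1 / \<sigma> k) *\<^sub>R (l k - exact k) \<in> V"
    by (rule topological_tendstoD[OF scaled_prox_step_tendsto UV(3,4)])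
  moreover have "\<forall>\<^sub>F k in sequentially. \<delta> k < 1"
    by (rule order_tendstoD(2)[OF summable_LIMSEQ_zero[OF \<delta>(2)]]) simp
  ultimately show ?thesis
  proof eventually_elim
    case (elim k)
    define n D where "n = norm (l (Suc k) - l k)" and "D = infdist (l k) S"
    \<comment> \<open>The scaled proximal step is a subgradient at \<open>exact k\<close>, so its
      norm bounds the distance in the subregularity inequality.\<close>
    have "(1 / \<sigma> k) *\<^sub>R (l k - exact k) \<in> {v. dual_sub v (exact k)} \<inter> V" using elim dual_sub_exact by simp
    then have "infdist (exact k) S \<le> \<kappa> * norm ((1 / \<sigma> k) *\<^sub>R (l k - exact k))"
      using sub'[OF elim(1)] infdist_le[of _ "{v. dual_sub v (exact k)} \<inter> V" 0] \<kappa>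
      by (smt (verit) dist_0_norm empty_iff mult_left_mono)
    then have "infdist (exact k) S \<le> rate_d \<kappa> (\<sigma> k) * D"
      using prox_contraction[OF \<sigma>_pos \<kappa>, of k "l k"] \<sigma>_pos[of k] unfolding exact_def S_def D_def by simp
    moreover have err: "norm (l (Suc k) - exact k) \<le> \<delta> k * n"
      using gap'[of k] \<delta>(1)[of k] by (intro multiplier_error) (auto simp: n_def power_mult_distrib)
    moreover have "infdist (l (Suc k)) S \<le> infdist (exact k) S + norm (l (Suc k) - exact k)"
      using infdist_triangle[of "l (Suc k)" S "exact k"] by (simp add: dist_norm)
    ultimately have le: "infdist (l (Suc k)) S \<le> rate_d \<kappa> (\<sigma> k) * D + \<delta> k * n" by linarith
    have "n \<le> norm (l (Suc k) - exact k) + norm (l k - exact k)"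
      using norm_triangle_ineq4[of "l (Suc k) - exact k" "l k - exact k"] by (simp add: n_def)
    then have n: "n * (1 - \<delta> k) \<le> D"
      using err prox_step_le_infdist[OF \<sigma>_pos, of "l k" k] by (simp add: exact_def D_def S_def algebra_simps)
    have "0 \<le> rate_d \<kappa> (\<sigma> k)" using \<kappa> by (simp add: rate_d_def)
    moreover have D0: "0 \<le> D" by (simp add: D_def infdist_nonneg)
    ultimately have "\<delta> k * (rate_d \<kappa> (\<sigma> k) * D) \<ge> 0" using \<delta>(1)[of k] by simp
    moreover have "\<delta> k * (n * (1 - \<delta> k)) \<le> \<delta> k * D" using n \<delta>(1)[of k] by (rule mult_left_mono)
    ultimately have "(rate_d \<kappa> (\<sigma> k) * D + \<delta> k * n) * (1 - \<delta> k) \<le> (rate_d \<kappa> (\<sigma> k) + \<delta> k) * D"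
      by (simp add: algebra_simps)
    then have "rate_d \<kappa> (\<sigma> k) * D + \<delta> k * n \<le> (rate_d \<kappa> (\<sigma> k) + \<delta> k) * D / (1 - \<delta> k)"
      using elim(3) by (simp add: pos_le_divide_eq)
    then show ?case using le by (simp add: D_def)
  qed
qed

text \<open>The KKT operator at the new iterate is the subdifferential of \<^const>\<open>Phi\<close> times the residual
  \<open>p - G u\<close>, which is a multiple of the multiplier step.\<close>

lemma primal_rate:
  assumes sub: "metric_subreg kkt (pr ls, G (pr ls), ls) 0 \<kappa>" and l: "l \<longlonglongrightarrow> ls" and ls: "dual_sub 0 ls"
    and \<delta>: "\<And>k. 0 \<le> \<delta> k" "\<delta> \<longlonglongrightarrow> 0"
    and crit: "\<And>k. infdist 0 (subdiff (\<lambda>w. ereal (Phi a (\<sigma> k) (l k) w)) (u (Suc k), p (Suc k)))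
      \<le> \<delta> k / \<sigma> k * norm (l (Suc k) - l k)"
  shows "\<forall>\<^sub>F k in sequentially. norm ((u (Suc k), p (Suc k)) - (pr ls, G (pr ls)))
    \<le> \<kappa> * (1 + \<delta> k) / \<sigma> k * norm (l (Suc k) - l k)"
proof -
  let ?w = "\<lambda>k. (u (Suc k), p (Suc k), l (Suc k))"
  obtain U V where UV: "open U" "(pr ls, G (pr ls), ls) \<in> U" "open V" "0 \<in> V" and \<kappa>: "0 \<le> \<kappa>"
    and sub': "\<And>y. y \<in> U \<Longrightarrow> kkt y \<inter> V \<noteq> {} \<Longrightarrow>
      infdist y {y'. 0 \<in> kkt y'} \<le> \<kappa> * infdist 0 (kkt y \<inter> V)"
    and zero: "0 \<in> kkt (pr ls, G (pr ls), ls)"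
    using sub unfolding metric_subreg_def by auto
  define t where "t k = (1 + \<delta> k) * (norm (l (Suc k) - l k) / \<sigma> k)" for k
  have "\<exists>w\<in>kkt (?w k). norm w \<le> t k" for k
  proof -
    let ?D = "subdiff (\<lambda>w. ereal (Phi a (\<sigma> k) (l k) w)) (u (Suc k), p (Suc k))"
    have D: "?D = {H (u (Suc k)) - f + adjoint G (l (Suc k))} \<times> (\<lambda>g. - l (Suc k) + g) ` face (p (Suc k))"
      using subdiff_Phi[OF \<sigma>_pos[of k], of a "l k" "u (Suc k)" "p (Suc k)"] by (simp add: l_Suc)
    \<comment> \<open>Closedness yields a subgradient of least norm, so (B2) bounds an actual
      element.\<close>
    have "closed ?D" unfolding D by (intro closed_Times closed_translation closed_face closed_singleton)
    moreover have "?D \<noteq> {}" unfolding D using face_nonempty by simp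
    ultimately obtain v b where vb: "(v, b) \<in> ?D" "infdist 0 ?D = norm (v, b)"
      using infdist_attains_inf[of ?D 0] by (metis dist_0_norm surj_pair)
    let ?c = "p (Suc k) - G (u (Suc k))"
    have "(v, b, ?c) \<in> kkt (?w k)" using vb(1) unfolding D by (auto simp: kkt_def)
    moreover have "norm (v, b, ?c) \<le> t k"
    proof -
      have "norm ?c = norm (l (Suc k) - l k) / \<sigma> k"
        unfolding residual using \<sigma>_pos[of k] by simp
      then show ?thesis
        using norm_triple_le[of v b ?c] crit[of k] unfolding vb(2) t_def by (simp add: distrib_right add_divide_distrib)
    qed
    ultimately show ?thesis by blast
  qed
  then obtain w where w: "\<And>k. w k \<in> kkt (?w k)" "\<And>k. norm (w k) \<le> t k" by metis
  have "t \<longlonglongrightarrow> (1 + 0) * 0"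
    unfolding t_def by (intro tendsto_intros \<delta> residual_tendsto[OF l])
  then have "w \<longlonglongrightarrow> 0" using w(2) by (intro Lim_null_comparison[of w t]) auto
  then have "\<forall>\<^sub>F k in sequentially. w k \<in> V" by (rule topological_tendstoD[OF _ UV(3,4)])
  moreover have "?w \<longlonglongrightarrow> (pr ls, G (pr ls), ls)"
    by (intro tendsto_Pair LIMSEQ_Suc[OF u_tendsto] LIMSEQ_Suc[OF p_tendsto] LIMSEQ_Suc l)
  then have "\<forall>\<^sub>F k in sequentially. ?w k \<in> U" by (rule topological_tendstoD[OF _ UV(1,2)])
  ultimately show ?thesis
  proof eventually_elim
    case (elim k)
    \<comment> \<open>All zeros of \<open>kkt\<close> share the same primal pair, so the distance to
      the zero set dominates the primal error.\<close>
    have "norm ((u (Suc k), p (Suc k)) - (pr ls, G (pr ls))) \<le> infdist (?w k) {y'. 0 \<in> kkt y'}"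
    proof -
      have "norm ((u (Suc k), p (Suc k)) - (pr ls, G (pr ls))) \<le> dist (?w k) y" if "0 \<in> kkt y" for y
      proof -
        obtain u' p' q' where y: "y = (u', p', q')" by (cases y)
        have "u' = pr ls" "p' = G (pr ls)"
          using kkt_zeroD[of u' p' q'] that pr_unique[OF ls] unfolding y by auto
        then show ?thesis
          using norm_Pair_le_triple[of "u (Suc k) - pr ls" "p (Suc k) - G (pr ls)" "l (Suc k) - q'"]
          by (simp add: y dist_norm)
      qed
      moreover have ne: "{y'. 0 \<in> kkt y'} \<noteq> {}" using zero by blast
      ultimately show ?thesis unfolding infdist_notempty[OF ne] by (intro cINF_greatest ne) auto
    qed
    also have "\<dots> \<le> \<kappa> * infdist 0 (kkt (?w k) \<inter> V)"
      using sub'[OF elim(2)] w(1)[of k] elim(1) by blast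
    also have "\<dots> \<le> \<kappa> * t k"
      using infdist_le[of "w k" "kkt (?w k) \<inter> V" 0] w[of k] elim(1) \<kappa>
      by (intro mult_left_mono) auto
    finally show ?case by (simp add: t_def)
  qed
qed

end

subsection \<open>Anisotropic total variation\<close>

lemma linear_grad: "linear (grad :: ('m::{finite,linorder}, 'n::{finite,linorder}) img \<Rightarrow> _)"
  by (intro linearI) (auto simp: grad_def grad1_def grad2_def vec_eq_iff algebra_simps)

lemma Basis_fld:
  "(Basis :: ('m::{finite,linorder}, 'n::{finite,linorder}) fld set)
    = (\<Union>i. {(axis i 1, 0), (0, axis i 1)})"
  by (auto simp: Basis_prod_def Basis_vec_def)

lemma inner_fld:
  fixes q :: "('m::{finite,linorder}, 'n::{finite,linorder}) fld"
  shows "q \<bullet> p = (\<Sum>x\<in>UNIV. fst q $ x * fst p $ x + snd q $ x * snd p $ x)"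
  by (simp add: inner_prod_def inner_vec_def sum.distrib)

lemma box_inf_Basis: "box_inf \<alpha> = {q. \<forall>b\<in>Basis. \<bar>q \<bullet> b\<bar> \<le> \<alpha>}"
  by (auto simp: box_inf_def Basis_fld inner_prod_def inner_axis)

lemma bounded_box_inf: "bounded (box_inf \<alpha>)"
proof -
  have "norm q \<le> (\<Sum>b\<in>(Basis :: ('a, 'b) fld set). \<alpha>)" if "q \<in> box_inf \<alpha>" for q :: "('a, 'b) fld"
    using that by (intro order_trans[OF norm_le_l1] sum_mono) (simp add: box_inf_Basis)
  then show ?thesis unfolding bounded_iff by blast
qed

lemma box_inf_iff_norm1:
  assumes "0 \<le> \<alpha>"
  shows "q \<in> box_inf \<alpha> \<longleftrightarrow> (\<forall>p. q \<bullet> p \<le> \<alpha> * norm1 p)"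
proof (intro iffI allI)
  fix p assume q: "q \<in> box_inf \<alpha>"
  have mult: "s * t \<le> \<alpha> * \<bar>t\<bar>" if "\<bar>s\<bar> \<le> \<alpha>" for s t :: real
  proof -
    have "s * t \<le> \<bar>s\<bar> * \<bar>t\<bar>" using abs_ge_self[of "s * t"] by (simp add: abs_mult)
    also have "\<dots> \<le> \<alpha> * \<bar>t\<bar>" using that by (rule mult_right_mono) simp
    finally show ?thesis .
  qed
  show "q \<bullet> p \<le> \<alpha> * norm1 p"
    unfolding inner_fld norm1_def sum_distrib_left distrib_left
    using q by (intro sum_mono add_mono mult) (auto simp: box_inf_def)
next
  assume le: "\<forall>p. q \<bullet> p \<le> \<alpha> * norm1 p"
  have "\<bar>q \<bullet> b\<bar> \<le> \<alpha>" if "b \<in> Basis" for b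
  proof -
    have "norm1 b = 1" "norm1 (- b) = 1"
      using that by (auto simp: Basis_fld norm1_def axis_def sum.distrib if_distrib[of abs] if_distrib[of uminus] cong: if_cong)
    then show ?thesis using le[rule_format, of b] le[rule_format, of "- b"] by simp
  qed
  then show "q \<in> box_inf \<alpha>" by (simp add: box_inf_Basis)
qed

lemma box_inf_attains_norm1:
  assumes "0 \<le> \<alpha>"
  shows "\<exists>q\<in>box_inf \<alpha>. q \<bullet> p = \<alpha> * norm1 p"
proof
  let ?q = "(\<chi> x. \<alpha> * sgn (fst p $ x), \<chi> x. \<alpha> * sgn (snd p $ x))"
  show "?q \<in> box_inf \<alpha>" using assms by (auto simp: box_inf_def abs_mult abs_sgn_eq)
  show "?q \<bullet> p = \<alpha> * norm1 p"
    by (simp add: inner_fld norm1_def sum_distrib_left distrib_left abs_sgn mult.assoc mult.commute[of "sgn _"])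
qed

text \<open>By the parallelogram law the midpoint of two solutions with different images would have
  a smaller objective. This identifies the common value described by \<open>THE\<close> in
  \<open>assumption1\<close>.\<close>

lemma model_solutions_image:
  assumes A: "linear A" and q: "q \<in> model_solutions A b 0 a0 \<alpha>"
  shows "A ` model_solutions A b 0 a0 \<alpha> = {A q}"
proof -
  have "A q' = A q" if q': "q' \<in> model_solutions A b 0 a0 \<alpha>" for q'
  proof -
    let ?a = "A q - b" and ?a' = "A q' - b" and ?m = "(1 / 2) *\<^sub>R (q + q')"
    have feas: "block q i \<in> cball 0 \<alpha>" "block q' i \<in> cball 0 \<alpha>" for i
      using q q' by (simp_all add: model_solutions_def Let_def del: split_paired_All mem_cball)
    have min: "(norm ?a)\<^sup>2 \<le> (norm (A y - b))\<^sup>2" "(norm ?a')\<^sup>2 \<le> (norm (A y - b))\<^sup>2"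
      if "\<forall>i. block y i \<in> cball 0 \<alpha>" for y
      using q q' that by (simp_all add: model_solutions_def Let_def del: split_paired_All mem_cball)
    have "block ?m i = (1 / 2) *\<^sub>R block q i + (1 / 2) *\<^sub>R block q' i" for i
      by (simp add: block_def)
    moreover have "(1 / 2) *\<^sub>R block q i + (1 / 2) *\<^sub>R block q' i \<in> cball 0 \<alpha>" for i
      using feas by (intro convexD[OF convex_cball]) auto
    ultimately have "\<forall>i. block ?m i \<in> cball 0 \<alpha>" by metis
    then have "(norm ?a)\<^sup>2 \<le> (norm (A ?m - b))\<^sup>2" by (rule min(1))
    moreover have "(norm ?a)\<^sup>2 = (norm ?a')\<^sup>2" by (intro antisym min allI feas)
    moreover have eq: "2 *\<^sub>R (A ?m - b) = ?a + ?a'"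
      by (simp add: linear_cmul[OF A] linear_add[OF A] scaleR_diff_right scaleR_2)
    have "(norm (?a + ?a'))\<^sup>2 = 4 * (norm (A ?m - b))\<^sup>2"
      unfolding eq[symmetric] by (simp add: power_mult_distrib)
    moreover have "(norm (v - w))\<^sup>2 + (norm (v + w))\<^sup>2 = 2 * (norm v)\<^sup>2 + 2 * (norm w)\<^sup>2"
      for v w :: "('a, 'b) img"
      by (simp add: power2_norm_eq_inner inner_simps)
    note this[of ?a ?a']
    ultimately have "(norm (?a - ?a'))\<^sup>2 \<le> 0" by linarith
    then show ?thesis by simp
  qed
  then show ?thesis using q by blast
qed

section \<open>The total variation problem as an instance\<close>

locale tv_problem =
  fixes K :: "('m::{finite,linorder}, 'n::{finite,linorder}) img \<Rightarrow> ('m, 'n) img"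
    and z :: "('m, 'n) img" and \<mu> \<alpha> :: real
  assumes linear_K: "linear K" and \<mu>: "0 \<le> \<mu>" and \<alpha>: "0 < \<alpha>" and pd: "pos_def (H_op K \<mu>)"
begin

lemma H_op_inner: "H_op K \<mu> v \<bullet> w = \<mu> * (grad v \<bullet> grad w) + K v \<bullet> K w"
  by (simp add: H_op_def inner_add_left adjoint_works linear_K linear_grad)
    (simp add: inner_commute adjoint_works linear_K linear_grad)

lemma linear_H_op: "linear (H_op K \<mu>)"
  unfolding H_op_def[abs_def]
  by (intro linear_compose_add linear_compose_scale_right
      linear_compose[unfolded o_def, OF linear_grad adjoint_linear[OF linear_grad]]
      linear_compose[unfolded o_def, OF linear_K adjoint_linear[OF linear_K]])

sublocale dual_qp "H_op K \<mu>" grad "adjoint K z" "box_inf \<alpha>" "\<lambda>p. \<alpha> * norm1 p"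
proof (rule dual_qp.intro)
  show "H_op K \<mu> v \<bullet> w = v \<bullet> H_op K \<mu> w" for v w
    using H_op_inner[of v w] H_op_inner[of w v] by (simp add: inner_commute)
  show "q \<in> box_inf \<alpha> \<longleftrightarrow> (\<forall>p. q \<bullet> p \<le> \<alpha> * norm1 p)" for q
    using \<alpha> by (intro box_inf_iff_norm1) simp
  show "\<exists>q\<in>box_inf \<alpha>. q \<bullet> p = \<alpha> * norm1 p" for p
    using \<alpha> by (intro box_inf_attains_norm1) simp
qed (use pd in \<open>auto simp: pos_def_def linear_grad bounded_box_inf linear_H_op\<close>)

lemma D_fun_eq: "D_fun K z \<mu> u = H_op K \<mu> u \<bullet> u / 2 - adjoint K z \<bullet> u + (norm z)\<^sup>2 / 2"
proof -
  have "adjoint K z \<bullet> u = K u \<bullet> z"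
    using adjoint_works[OF linear_K, of u z] by (simp add: inner_commute)
  then show ?thesis
    unfolding D_fun_def H_op_inner power2_norm_eq_inner
    by (simp add: inner_diff_left inner_diff_right inner_commute field_simps)
qed

lemma aug_lag_eq: "aug_lag K z \<mu> \<alpha> s q = Phi ((norm z)\<^sup>2 / 2) s q"
  by (auto simp: aug_lag_def Phi_def D_fun_eq)

lemma dual_obj_eq: "dual_obj K z \<mu> \<alpha> q = ereal (Q q - (norm z)\<^sup>2 / 2) + cvx_ind (box_inf \<alpha>) q"
  by (simp add: dual_obj_def div_op_def Q_def Let_def)

lemma T_d_eq: "T_d K z \<mu> \<alpha> = (\<lambda>q. {v. dual_sub v q})"
  unfolding T_d_def using subdiff_dual[of "(norm z)\<^sup>2 / 2"]
  by (simp add: dual_obj_eq[abs_def] fun_eq_iff)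

lemma dual_solutions_eq: "dual_solutions K z \<mu> \<alpha> = {q. dual_sub 0 q}"
  unfolding dual_solutions_def dual_obj_eq by (rule minimizers_dual)

lemma face_eq_sub_norm1: "face p = (\<lambda>g. \<alpha> *\<^sub>R g) ` sub_norm1 p"
proof -
  have iff: "\<alpha> *\<^sub>R g \<in> face p \<longleftrightarrow> g \<in> sub_norm1 p" for g
  proof -
    have "\<alpha> *\<^sub>R g \<in> face p \<longleftrightarrow> (\<forall>y. \<alpha> * (norm1 p + g \<bullet> (y - p)) \<le> \<alpha> * norm1 y)"
      unfolding subdiff_h[symmetric] subdiff_def by (simp add: distrib_left)
    then show ?thesis using \<alpha> by (simp add: sub_norm1_def subdiff_def)
  qed
  have "g \<in> (\<lambda>g. \<alpha> *\<^sub>R g) ` sub_norm1 p" if "g \<in> face p" for g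
    using that \<alpha> iff[of "(1 / \<alpha>) *\<^sub>R g"] by (intro image_eqI[of _ _ "(1 / \<alpha>) *\<^sub>R g"]) auto
  then show ?thesis using iff by blast
qed

lemma T_l_eq: "T_l K z \<mu> \<alpha> = kkt"
  by (simp add: T_l_def kkt_def face_eq_sub_norm1 image_image)

text \<open>With \<open>s = 0\<close> and \<open>p = grad v\<close> the coupling and the penalty
  vanish, so \<open>Phi\<close> is the primal objective; its increment from \<open>pr q\<close> is a
  sum of nonnegative terms.\<close>

lemma primal_solution_pr:
  assumes "dual_sub 0 q"
  shows "primal_solution K z \<mu> \<alpha> (pr q) (grad (pr q))"
proof -
  have obj: "primal_obj K z \<mu> \<alpha> v = Phi ((norm z)\<^sup>2 / 2) 0 q (v, grad v)" for v
    by (simp add: primal_obj_def D_fun_eq Phi_def)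
  have "q \<in> face (grad (pr q))" using face_iff_dual[of q 0] assms by simp
  then have "Phi ((norm z)\<^sup>2 / 2) 0 q (pr q, grad (pr q)) \<le> Phi ((norm z)\<^sup>2 / 2) 0 q (v, grad v)" for v
    using Phi_expand[of "(norm z)\<^sup>2 / 2" 0 q "pr q" "v - pr q" "grad (pr q)" "grad v - grad (pr q)"]
      face_ineq[of q "grad (pr q)" "grad v - grad (pr q)"] energy_nonneg[of "v - pr q"]
    by (simp add: H_pr)
  then show ?thesis by (simp add: primal_solution_def obj)
qed

text \<open>A dual solution on the disc that also solves the problem on the larger box satisfies the
  optimality conditions of the box. On the boundary of the disc they admit a nonzero gradient only
  at the four points where the disc touches the box.\<close>

lemma assumption1_strict_complementarity:
  assumes q: "dual_sub 0 q" and as1: "dual_assumption1 K z \<mu> \<alpha> q" and b: "b \<in> Basis"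
  shows "\<bar>q \<bullet> b\<bar> < \<alpha> \<or> grad (pr q) \<bullet> b \<noteq> 0"
proof -
  define R where "R = psd_sqrt (inv (H_op K \<mu>))"
  note R = psd_sqrt[OF linear_inv sym_inv inv_nonneg, folded R_def]
  \<comment> \<open>\<open>R\<close> enters the gradient only in pairs, where the square root turns
    back into \<open>inv (H_op K \<mu>)\<close>.\<close>
  have R_inner: "R v \<bullet> R w = inv (H_op K \<mu>) v \<bullet> w" for v w
    using adjoint_works[OF R(1), of w "R v"] R(2,3) by (simp add: inner_commute)
  let ?A = "R \<circ> div_op" and ?b = "- R (adjoint K z)"
  have "linear (div_op :: ('m, 'n) fld \<Rightarrow> _)"
    unfolding div_op_def[abs_def] by (intro linear_compose_neg linear_adj)
  then have A: "linear ?A" by (intro linear_compose R)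
  let ?M = "model_solutions ?A ?b 0 (- (norm z)\<^sup>2 / 2) \<alpha>"
  define g where "g = adjoint ?A (?A q - ?b) + 0"
  have as: "assumption1 ?A ?b 0 (- (norm z)\<^sup>2 / 2) \<alpha> q"
    using as1 by (simp add: dual_assumption1_def R_def Let_def)
  then have "q \<in> ?M" by (simp add: assumption1_def Let_def)
  then have the: "(THE y. ?A ` ?M = {y}) = ?A q"
    using model_solutions_image[OF A] by (intro the_equality) auto
  then have blocks: "(block q i \<in> frontier (cball 0 \<alpha>) \<and> block g i \<noteq> 0) \<or> block q i \<in> interior (cball 0 \<alpha>)" for i
    using as unfolding assumption1_def Let_def the g_def[symmetric] by blast
  have g: "g = - grad (pr q)"
  proof (rule vector_eq_rdot[THEN iffD1, rule_format])
    fix e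
    have "g \<bullet> e = (?A q - ?b) \<bullet> ?A e"
      unfolding g_def using adjoint_works[OF A, of e "?A q - ?b"] by (simp only: inner_commute add_0_right)
    also have "?A q - ?b = R (adjoint K z - adjoint grad q)"
      by (simp add: div_op_def linear_diff[OF R(1)] linear_neg[OF R(1)])
    also have "\<dots> \<bullet> ?A e = - grad (pr q) \<bullet> e"
      by (simp add: R_inner div_op_def adj flip: pr_def)
    finally show "g \<bullet> e = - grad (pr q) \<bullet> e" .
  qed
  have q_inactive: "grad (pr q) \<bullet> c = 0" if "c \<in> Basis" "\<bar>q \<bullet> c\<bar> < \<alpha>" for c
    using box_inactive[OF box_inf_Basis \<alpha> q that] by simp
  obtain i where i: "b = (axis i 1, 0) \<or> b = (0, axis i 1)" using b by (auto simp: Basis_fld)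
  let ?e1 = "(axis i 1, 0) :: ('m, 'n) fld" and ?e2 = "(0, axis i 1) :: ('m, 'n) fld"
  have eB: "?e1 \<in> Basis" "?e2 \<in> Basis" unfolding Basis_fld by blast+
  have e: "w \<bullet> ?e1 = fst (block w i)" "w \<bullet> ?e2 = snd (block w i)" for w
    by (simp_all add: block_def inner_prod_def inner_axis)
  from blocks[of i] show ?thesis
  proof
    assume "block q i \<in> interior (cball 0 \<alpha>)"
    then have "norm (block q i) < \<alpha>" by simp
    then have "\<bar>q \<bullet> ?e1\<bar> < \<alpha>" "\<bar>q \<bullet> ?e2\<bar> < \<alpha>"
      unfolding e
      using norm_fst_le[of "fst (block q i)" "snd (block q i)"] norm_snd_le[of "snd (block q i)" "fst (block q i)"]
      by simp_all
    then show ?thesis using i by blast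
  next
    assume f: "block q i \<in> frontier (cball 0 \<alpha>) \<and> block g i \<noteq> 0"
    then have "norm (block q i) = \<alpha>" using \<alpha> by (simp add: frontier_cball)
    moreover have "(norm (block q i))\<^sup>2 = (q \<bullet> ?e1)\<^sup>2 + (q \<bullet> ?e2)\<^sup>2"
      unfolding e norm_prod_def by simp
    ultimately have sq: "(q \<bullet> ?e1)\<^sup>2 + (q \<bullet> ?e2)\<^sup>2 = \<alpha>\<^sup>2"
      by simp
    have nz: "grad (pr q) \<bullet> ?e1 \<noteq> 0 \<or> grad (pr q) \<bullet> ?e2 \<noteq> 0"
      using f unfolding e g by (auto simp: block_def prod_eq_iff)
    \<comment> \<open>If coordinate \<open>c\<close> reaches the bound, the disc forces
      \<open>q \<bullet> c' = 0\<close>, so \<open>c'\<close> is inactive and its gradient component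
      vanishes; the nonzero gradient must sit in \<open>c\<close>.\<close>
    have other: "grad (pr q) \<bullet> c \<noteq> 0"
      if "\<not> \<bar>q \<bullet> c\<bar> < \<alpha>" "(q \<bullet> c)\<^sup>2 + (q \<bullet> c')\<^sup>2 = \<alpha>\<^sup>2" "c' \<in> Basis"
        "grad (pr q) \<bullet> c \<noteq> 0 \<or> grad (pr q) \<bullet> c' \<noteq> 0" for c c'
    proof -
      have "\<alpha>\<^sup>2 \<le> (q \<bullet> c)\<^sup>2" using that(1) \<alpha> by (metis abs_le_square_iff abs_of_pos not_less)
      then have "q \<bullet> c' = 0" using that(2) by (metis add_le_same_cancel1 le_add_same_cancel1 order_antisym zero_le_power2 power_eq_0_iff)
      then show ?thesis using q_inactive[OF that(3)] \<alpha> that(4) by auto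
    qed
    from i show ?thesis
    proof
      assume "b = ?e1" then show ?thesis using other[of ?e1 ?e2] sq nz eB by blast
    next
      assume "b = ?e2" then show ?thesis using other[of ?e2 ?e1] sq nz eB by (metis add.commute)
    qed
  qed
qed

lemma T_d_subreg:
  assumes "dual_sub 0 q" "dual_assumption1 K z \<mu> \<alpha> q"
  shows "\<exists>\<kappa>. metric_subreg (T_d K z \<mu> \<alpha>) q 0 \<kappa>"
  unfolding T_d_eq
  by (rule strict_complementarity_subreg[OF box_inf_Basis \<alpha> assms(1)])
    (rule assumption1_strict_complementarity[OF assms])

end

theorem theorem4:
  fixes K :: "('m::{finite,linorder}, 'n::{finite,linorder}) img \<Rightarrow> ('m, 'n) img"
    and z :: "('m, 'n) img"
    and \<mu> \<alpha> :: real
    and \<sigma> :: "nat \<Rightarrow> real" and sigma_inf :: real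
    and u :: "nat \<Rightarrow> ('m, 'n) img" and p l :: "nat \<Rightarrow> ('m, 'n) fld"
    and \<epsilon> :: "nat \<Rightarrow> real"
  assumes "linear K" and "0 \<le> \<mu>" and "0 < \<alpha>" and "pos_def (H_op K \<mu>)"
    and "\<forall>k. 0 < \<sigma> k" and "incseq \<sigma>" and "\<sigma> \<longlonglongrightarrow> sigma_inf"
    and "alm_sequence \<alpha> \<sigma> u p l"
    and "crit_A K z \<mu> \<alpha> \<sigma> u p l \<epsilon>"
  shows "\<exists>us ps ls.
    primal_solution K z \<mu> \<alpha> us ps \<and> ls \<in> dual_solutions K z \<mu> \<alpha> \<and>
    bounded (range (\<lambda>k. (u k, p k, l k))) \<and>
    (\<lambda>k. (u k, p k, l k)) \<longlonglongrightarrow> (us, ps, ls) \<and>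
    (dual_assumption1 K z \<mu> \<alpha> ls \<longrightarrow>
      (\<exists>\<kappa>d. metric_subreg (T_d K z \<mu> \<alpha>) ls 0 \<kappa>d) \<and>
      (\<forall>\<kappa>d \<delta>. metric_subreg (T_d K z \<mu> \<alpha>) ls 0 \<kappa>d \<and> crit_B1 K z \<mu> \<alpha> \<sigma> u p l \<delta> \<longrightarrow>
        (let \<theta> = (\<lambda>k. (rate_d \<kappa>d (\<sigma> k) + \<delta> k) / (1 - \<delta> k));
             theta_inf = rate_d \<kappa>d sigma_inf
         in l \<longlonglongrightarrow> ls \<and>
            (\<forall>\<^sub>F k in sequentially.
               infdist (l (Suc k)) (dual_solutions K z \<mu> \<alpha>)
                 \<le> \<theta> k * infdist (l k) (dual_solutions K z \<mu> \<alpha>)) \<and>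
            \<theta> \<longlonglongrightarrow> theta_inf \<and> theta_inf < 1) \<and>
        (\<forall>\<kappa>l \<delta>'. metric_subreg (T_l K z \<mu> \<alpha>) (us, ps, ls) 0 \<kappa>l \<and>
                  crit_B2 K z \<mu> \<alpha> \<sigma> u p l \<delta>' \<longrightarrow>
          (let \<theta>' = (\<lambda>k. \<kappa>l * (1 + \<delta>' k) / \<sigma> k)
           in (\<forall>\<^sub>F k in sequentially.
                 norm ((u (Suc k), p (Suc k)) - (us, ps)) \<le> \<theta>' k * norm (l (Suc k) - l k)) \<and>
              \<theta>' \<longlonglongrightarrow> \<kappa>l / sigma_inf))))"
proof -
  interpret tv_problem K z \<mu> \<alpha> using assms by (intro tv_problem.intro)
  interpret inexact_alm "H_op K \<mu>" grad "adjoint K z" "box_inf \<alpha>" "\<lambda>p. \<alpha> * norm1 p"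
    "(norm z)\<^sup>2 / 2" \<sigma> sigma_inf u p l \<epsilon>
    using assms(5-9) by unfold_locales (auto simp: alm_sequence_def crit_A_def aug_lag_eq)
  \<comment> \<open>The limit is fixed before any regularity is assumed; both rates refer to this
    \<open>ls\<close>, and the primal solution is \<open>pr ls\<close>.\<close>
  obtain ls where ls: "dual_sub 0 ls" "l \<longlonglongrightarrow> ls" using l_converges by blast
  let ?us = "pr ls" and ?ps = "grad (pr ls)"
  have conv: "(\<lambda>k. (u k, p k, l k)) \<longlonglongrightarrow> (?us, ?ps, ls)"
    by (intro tendsto_Pair u_tendsto p_tendsto ls)
  have dual_rate: "(\<forall>\<^sub>F k in sequentially. infdist (l (Suc k)) (dual_solutions K z \<mu> \<alpha>)
        \<le> (rate_d \<kappa> (\<sigma> k) + \<delta> k) / (1 - \<delta> k) * infdist (l k) (dual_solutions K z \<mu> \<alpha>)) \<and>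
      (\<lambda>k. (rate_d \<kappa> (\<sigma> k) + \<delta> k) / (1 - \<delta> k)) \<longlonglongrightarrow> rate_d \<kappa> sigma_inf"
    if "metric_subreg (T_d K z \<mu> \<alpha>) ls 0 \<kappa>" "crit_B1 K z \<mu> \<alpha> \<sigma> u p l \<delta>" for \<kappa> \<delta>
  proof
    show "\<forall>\<^sub>F k in sequentially. infdist (l (Suc k)) (dual_solutions K z \<mu> \<alpha>)
        \<le> (rate_d \<kappa> (\<sigma> k) + \<delta> k) / (1 - \<delta> k) * infdist (l k) (dual_solutions K z \<mu> \<alpha>)"
      unfolding dual_solutions_eq using that ls(2)
      by (intro linear_rate) (auto simp: T_d_eq crit_B1_def aug_lag_eq)
    have "\<delta> \<longlonglongrightarrow> 0" using that(2) by (auto simp: crit_B1_def intro: summable_LIMSEQ_zero)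
    then have "(\<lambda>k. (rate_d \<kappa> (\<sigma> k) + \<delta> k) / (1 - \<delta> k)) \<longlonglongrightarrow> (rate_d \<kappa> sigma_inf + 0) / (1 - 0)"
      by (intro tendsto_intros rate_d_tendsto) auto
    then show "(\<lambda>k. (rate_d \<kappa> (\<sigma> k) + \<delta> k) / (1 - \<delta> k)) \<longlonglongrightarrow> rate_d \<kappa> sigma_inf" by simp
  qed
  have primal: "(\<forall>\<^sub>F k in sequentially. norm ((u (Suc k), p (Suc k)) - (?us, ?ps))
        \<le> \<kappa> * (1 + \<delta> k) / \<sigma> k * norm (l (Suc k) - l k)) \<and>
      (\<lambda>k. \<kappa> * (1 + \<delta> k) / \<sigma> k) \<longlonglongrightarrow> \<kappa> / sigma_inf"
    if "metric_subreg (T_l K z \<mu> \<alpha>) (?us, ?ps, ls) 0 \<kappa>" "crit_B2 K z \<mu> \<alpha> \<sigma> u p l \<delta>" for \<kappa> \<delta>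
  proof
    show "\<forall>\<^sub>F k in sequentially. norm ((u (Suc k), p (Suc k)) - (?us, ?ps))
        \<le> \<kappa> * (1 + \<delta> k) / \<sigma> k * norm (l (Suc k) - l k)"
      using that ls by (intro primal_rate) (auto simp: T_l_eq crit_B2_def aug_lag_eq)
    have "(\<lambda>k. \<kappa> * (1 + \<delta> k) / \<sigma> k) \<longlonglongrightarrow> \<kappa> * (1 + 0) / sigma_inf"
      using that(2) sigma_inf_pos by (intro tendsto_intros \<sigma>_lim) (auto simp: crit_B2_def)
    then show "(\<lambda>k. \<kappa> * (1 + \<delta> k) / \<sigma> k) \<longlonglongrightarrow> \<kappa> / sigma_inf" by simp
  qed
  show ?thesis
    unfolding Let_def
  proof (rule exI[of _ ?us], rule exI[of _ ?ps], rule exI[of _ ls], intro conjI impI allI)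
    show "primal_solution K z \<mu> \<alpha> ?us ?ps" by (rule primal_solution_pr[OF ls(1)])
    show "ls \<in> dual_solutions K z \<mu> \<alpha>" using ls(1) by (simp add: dual_solutions_eq)
    show "bounded (range (\<lambda>k. (u k, p k, l k)))" by (rule convergent_imp_bounded[OF conv])
    show "(\<lambda>k. (u k, p k, l k)) \<longlonglongrightarrow> (?us, ?ps, ls)" by (rule conv)
    show "l \<longlonglongrightarrow> ls" by (rule ls(2))
  qed (use T_d_subreg[OF ls(1)] dual_rate primal rate_d_less in auto)
qed

end
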